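(* There is a universal constant $C>0$ such that the following holds for every integer $d\geq 1$. Let $\mathcal{F}$ be a family of convex sets in $\mathbb{R}^d$ such that the volume of its intersection satisfies $\operatorname{vol}\left(\bigcap\mathcal{F}\right)>0$. Then there is a subfamily $\mathcal{G}\subseteq\mathcal{F}$ with $|\mathcal{G}|\leq 2d$ and $$\operatorname{vol}\left(\bigcap\mathcal{G}\right)\leq C e^{d} d^{2d}\,\operatorname{vol}\left(\bigcap\mathcal{F}\right).$$
   Context: $\operatorname{vol}(\cdot)$ denotes $d$-dimensional volume (Lebesgue measure) in $\mathbb{R}^d$. For a family $\mathcal{H}$ of subsets of $\mathbb{R}^d$, $\bigcap\mathcal{H}$ denotes the intersection of all members of $\mathcal{H}$, and $|\mathcal{H}|$ denotes the number of members of $\mathcal{H}$. The family $\mathcal{F}$ is not assumed to be finite. "Universal constant" means that $C$ depends neither on $d$ nor on $\mathcal{F}$. *)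

theory Defs
  imports "HOL-Analysis.Analysis"
begin

text \<open>
  The universal constant is chosen before the dimension \<open>d\<close>, so \<open>d\<close> has to be a term and cannot
  be encoded in a type such as \<open>real ^ 'n\<close>. A point of $d$-dimensional space is therefore a
  function on the index set \<open>{..<d}\<close>, extended by \<open>undefined\<close> outside it, which is the
  representation of points in the library's finite product measures \<open>Pi\<^sub>M {..<d}\<close>.
\<close>

definition Rd :: "nat \<Rightarrow> (nat \<Rightarrow> real) set" where
  "Rd d = {..<d} \<rightarrow>\<^sub>E UNIV"

definition convex_in :: "nat \<Rightarrow> (nat \<Rightarrow> real) set \<Rightarrow> bool" where
  "convex_in d S \<longleftrightarrow>
     S \<subseteq> Rd d \<and>
     (\<forall>x\<in>S. \<forall>y\<in>S. \<forall>u\<ge>0. \<forall>v\<ge>0. u + v = 1 \<longrightarrow> (\<lambda>i\<in>{..<d}. u * x i + v * y i) \<in> S)"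

text \<open>
  Lebesgue measure on $d$-dimensional space. The completion is essential: convex sets are Lebesgue
  measurable but need not be Borel, and \<^const>\<open>emeasure\<close> is 0 on sets that are not measurable.
\<close>

definition vol :: "nat \<Rightarrow> (nat \<Rightarrow> real) set \<Rightarrow> ennreal" where
  "vol d = emeasure (completion (\<Pi>\<^sub>M i\<in>{..<d}. (lborel :: real measure)))"

text \<open>
  The intersection of a family of subsets of $d$-dimensional space; intersecting with \<open>Rd d\<close> only
  matters for the empty family, whose intersection is the whole space.
\<close>

definition family_Inter :: "nat \<Rightarrow> (nat \<Rightarrow> real) set set \<Rightarrow> (nat \<Rightarrow> real) set" where
  "family_Inter d \<F> = Rd d \<inter> \<Inter>\<F>"

end

theory Submission
  imports Defs "Jordan_Normal_Form.Determinant"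
begin

text \<open>
  Let \<open>K\<close> be the intersection of the family. If \<open>K\<close> has infinite volume, the empty subfamily works,
  so let the volume be finite and positive; then \<open>K\<close> is bounded and contains a small cube.

  The subfamily is found through half-spaces. Fix an origin in \<open>K\<close> and let \<open>X\<close> be the set of all
  vectors \<open>a\<close> such that some member of the family lies in the half-space \<open>\<langle>a, x\<rangle> \<le> 1\<close>. Two families
  of at most \<open>d\<close> vectors of \<open>X\<close> are chosen, and each vector contributes one member of the family.

  The first family is a basis \<open>u\<^sub>1, \<dots>, u\<^sub>d\<close> whose determinant is almost maximal among \<open>d\<close>-tuples from
  \<open>X\<close> (\<open>auerbach_system\<close>). By Cramer's rule every vector of \<open>X\<close> then has coordinates of absolute value
  at most \<open>\<rho>\<close>, slightly above 1, in this basis. So if \<open>\<langle>u\<^sub>l, y\<rangle> \<ge> 0\<close> for all \<open>l\<close> and these numbers add up to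
  less than \<open>1 / \<rho>\<close>, then \<open>\<langle>a, y\<rangle> < 1\<close> for every \<open>a \<in> X\<close>; and such a \<open>y\<close> lies in \<open>K\<close>, because a
  point missing from a member of the family is cut off by a half-space from \<open>X\<close>. Thus \<open>K\<close> contains a
  simplex \<open>A\<close> whose facets at the origin have the normals \<open>u\<^sub>l\<close>.

  The half-spaces \<open>\<langle>u\<^sub>l, y\<rangle> \<le> 1\<close> alone bound an unbounded cone, and the second family closes it off. It
  should have a vector \<open>w = - s (u\<^sub>1 + \<dots> + u\<^sub>d)\<close> in its convex hull together with the origin, with \<open>s\<close> not
  too small. Here the choice of the origin matters: it is the centroid of an almost largest simplex
  inscribed in \<open>K\<close>, which makes \<open>- K / (d + 1)\<close> a subset of \<open>K\<close> (\<open>reflection_center\<close>). Separation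
  then shows that \<open>s = 1 / (d (d + 2))\<close> is possible, and the conic form of Caratheodory's theorem
  (\<open>subconvex_hull_caratheodory\<close>) writes \<open>w\<close> with only \<open>d\<close> vectors of \<open>X\<close>.

  The chosen members of the family now intersect inside the region where \<open>\<langle>u\<^sub>l, y\<rangle> \<le> 1\<close> for all \<open>l\<close> and
  \<open>\<langle>w, y\<rangle> \<le> 1\<close>. This region is a simplex with the same facet normals as \<open>A\<close> up to sign, so it is a
  reflected homothetic copy of \<open>A\<close>, and its ratio is \<open>(d + 1) (d + 3)\<close> once \<open>\<rho>\<close> is close enough to 1.
  Hence the volume grows at most by the factor \<open>((d + 1) (d + 3))\<^sup>d \<le> e\<^sup>4 d\<^sup>2\<^sup>d\<close>. Only the behaviour of
  volume under translations and homotheties enters; determinants serve to select vectors and never to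
  compute a volume.
\<close>

section \<open>Linear algebra on coordinate functions\<close>

text \<open>
  Vectors are functions on \<open>nat\<close> of which only the first \<open>n\<close> values count. The dimension can then change
  within a proof.
\<close>

definition ip :: "nat \<Rightarrow> (nat \<Rightarrow> real) \<Rightarrow> (nat \<Rightarrow> real) \<Rightarrow> real" where
  "ip n a x = (\<Sum>i<n. a i * x i)"

lemma ip_cong: "(\<And>i. i < n \<Longrightarrow> x i = y i) \<Longrightarrow> ip n a x = ip n a y"
  by (auto simp: ip_def)

lemma ip_cong_left: "(\<And>i. i < n \<Longrightarrow> a i = b i) \<Longrightarrow> ip n a x = ip n b x"
  by (auto simp: ip_def)

lemma ip_commute: "ip n a x = ip n x a"
  by (simp add: ip_def mult.commute)

lemma ip_add: "ip n a (\<lambda>i. x i + y i) = ip n a x + ip n a y"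
  by (simp add: ip_def algebra_simps sum.distrib)

lemma ip_diff: "ip n a (\<lambda>i. x i - y i) = ip n a x - ip n a y"
  by (simp add: ip_def algebra_simps sum_subtractf)

lemma ip_scale: "ip n a (\<lambda>i. t * x i) = t * ip n a x"
  by (simp add: ip_def algebra_simps sum_distrib_left)

lemma ip_scale_left: "ip n (\<lambda>i. t * a i) x = t * ip n a x"
  by (simp add: ip_def algebra_simps sum_distrib_left)

lemma ip_sum: "ip n a (\<lambda>i. \<Sum>j\<in>J. t j * x j i) = (\<Sum>j\<in>J. t j * ip n a (x j))"
proof -
  have "ip n a (\<lambda>i. \<Sum>j\<in>J. t j * x j i) = (\<Sum>i<n. \<Sum>j\<in>J. t j * (a i * x j i))"
    by (simp add: ip_def sum_distrib_left algebra_simps)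
  also have "\<dots> = (\<Sum>j\<in>J. \<Sum>i<n. t j * (a i * x j i))" by (rule sum.swap)
  finally show ?thesis by (simp add: ip_def sum_distrib_left)
qed

lemma ip_sum_left: "ip n (\<lambda>i. \<Sum>j\<in>J. t j * a j i) x = (\<Sum>j\<in>J. t j * ip n (a j) x)"
  using ip_sum[where a = x and x = a] by (simp add: ip_commute)

text \<open>
  Induction on the number of coordinates: one vector with a nonzero last coordinate is used to
  eliminate that coordinate from all the others.
\<close>

lemma linear_dependency:
  fixes a :: "'j \<Rightarrow> nat \<Rightarrow> real"
  assumes "finite J" "n < card J"
  shows "\<exists>\<gamma>. (\<exists>j\<in>J. \<gamma> j \<noteq> 0) \<and> (\<forall>i<n. (\<Sum>j\<in>J. \<gamma> j * a j i) = 0)"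
  using assms
proof (induction n arbitrary: J a)
  case 0
  then obtain j where "j \<in> J" by (metis card.empty less_irrefl all_not_in_conv)
  then show ?case by (intro exI[of _ "\<lambda>_. 1"]) auto
next
  case (Suc n)
  show ?case
  proof (cases "\<forall>j\<in>J. a j n = 0")
    case True
    from Suc.IH[OF Suc.prems(1)] Suc.prems(2) obtain \<gamma> where
      "\<exists>j\<in>J. \<gamma> j \<noteq> 0" "\<forall>i<n. (\<Sum>j\<in>J. \<gamma> j * a j i) = 0" by (metis Suc_lessD)
    with True show ?thesis by (intro exI[of _ \<gamma>]) (auto simp: less_Suc_eq)
  next
    case False
    then obtain k where k: "k \<in> J" "a k n \<noteq> 0" by auto
    define J' where "J' = J - {k}"
    have J': "finite J'" "n < card J'" "J = insert k J'" "k \<notin> J'"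
      using k Suc.prems by (auto simp: J'_def)
    define b where "b j i = a j i - a j n / a k n * a k i" for j i
    obtain \<gamma> where g: "\<exists>j\<in>J'. \<gamma> j \<noteq> 0" "\<forall>i<n. (\<Sum>j\<in>J'. \<gamma> j * b j i) = 0"
      using Suc.IH[OF J'(1,2), of b] by blast
    define s where "s = - (\<Sum>j\<in>J'. \<gamma> j * a j n) / a k n"
    have eq: "(\<Sum>j\<in>J. (\<gamma>(k := s)) j * a j i) = (\<Sum>j\<in>J'. \<gamma> j * b j i)" for i
    proof -
      have "(\<Sum>j\<in>J. (\<gamma>(k := s)) j * a j i) = s * a k i + (\<Sum>j\<in>J'. (\<gamma>(k := s)) j * a j i)"
        using J' by simp
      also have "(\<Sum>j\<in>J'. (\<gamma>(k := s)) j * a j i) = (\<Sum>j\<in>J'. \<gamma> j * a j i)"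
        using J' by (intro sum.cong) auto
      finally show ?thesis
        by (simp add: b_def s_def algebra_simps sum_subtractf sum_distrib_left sum_divide_distrib
            sum_negf)
    qed
    have "b j n = 0" for j using k by (simp add: b_def)
    then have "(\<Sum>j\<in>J'. \<gamma> j * b j i) = 0" if "i < Suc n" for i
      using g(2) that by (cases "i = n") auto
    moreover have "\<exists>j\<in>J. (\<gamma>(k := s)) j \<noteq> 0" using g(1) J' by auto
    ultimately show ?thesis by (intro exI[of _ "\<gamma>(k := s)"]) (simp only: eq, simp)
  qed
qed

definition biorthogonal :: "nat \<Rightarrow> nat \<Rightarrow> (nat \<Rightarrow> nat \<Rightarrow> real) \<Rightarrow> (nat \<Rightarrow> nat \<Rightarrow> real) \<Rightarrow> bool" where
  "biorthogonal n k u f \<longleftrightarrow> (\<forall>j<k. \<forall>l<k. ip n (u j) (f l) = of_bool (j = l))"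

text \<open>
  The dual vectors are built along with the basis. While \<open>k < n\<close>, some nonzero \<open>v\<close> is orthogonal to all
  the \<open>u j\<close> found so far, and an element of \<open>X\<close> not orthogonal to \<open>v\<close> is the next basis vector; a multiple of
  \<open>v\<close> is its dual vector, and the earlier dual vectors are corrected by multiples of it.
\<close>

lemma biorthogonal_exists:
  assumes span: "\<And>v. \<exists>i<n. v i \<noteq> 0 \<Longrightarrow> \<exists>a\<in>X. ip n a v \<noteq> 0"
  shows "k \<le> n \<Longrightarrow> \<exists>u f. (\<forall>j<k. u j \<in> X) \<and> biorthogonal n k u f"
proof (induction k)
  case 0
  then show ?case by (auto simp: biorthogonal_def)
next
  case (Suc k)
  then obtain u f where u: "\<forall>j<k. u j \<in> X" and "biorthogonal n k u f"
    using Suc_leD by blast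
  then have uf: "ip n (u j) (f l) = of_bool (j = l)" if "j < k" "l < k" for j l
    using that by (auto simp: biorthogonal_def)
  obtain v where v: "\<exists>i\<in>{..<n}. v i \<noteq> 0" "\<forall>j<k. (\<Sum>i<n. v i * u j i) = 0"
    using linear_dependency[of "{..<n}" k "\<lambda>i j. u j i"] Suc.prems by auto
  then obtain a where a: "a \<in> X" "ip n a v \<noteq> 0" using span[of v] by auto
  have uv: "ip n (u j) v = 0" if "j < k" for j
    using v(2) that by (simp add: ip_def mult.commute)
  define g where "g i = v i / ip n a v" for i
  have g: "ip n b g = ip n b v / ip n a v" for b
    unfolding g_def ip_def by (simp add: sum_divide_distrib)
  define f' where "f' l i = f l i - ip n a (f l) * g i" for l i
  have f': "ip n b (f' l) = ip n b (f l) - ip n a (f l) * ip n b g" for b l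
    unfolding f'_def by (simp add: ip_diff ip_scale)
  show ?case
    by (rule exI[of _ "u(k := a)"], rule exI[of _ "f'(k := g)"])
      (use u uf a uv in \<open>auto simp: biorthogonal_def less_Suc_eq g f'\<close>)
qed

text \<open>
  The vectors \<open>u 0, \<dots>, u (n - 1), x\<close> are linearly dependent, and pairing the dependency with the dual
  vectors identifies its coefficients.
\<close>

lemma biorthogonal_expansion:
  assumes bi: "biorthogonal n n u f" and i: "i < n"
  shows "x i = (\<Sum>l<n. ip n x (f l) * u l i)"
proof -
  have uf: "ip n (u j) (f l) = of_bool (j = l)" if "j < n" "l < n" for j l
    using bi that by (auto simp: biorthogonal_def)
  define a where "a = u(n := x)"
  obtain \<gamma> where g: "\<exists>j\<in>{..n}. \<gamma> j \<noteq> 0" "\<And>i. i < n \<Longrightarrow> (\<Sum>j\<le>n. \<gamma> j * a j i) = 0"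
    using linear_dependency[of "{..n}" n a] by auto
  have "ip n (\<lambda>i. \<Sum>j\<le>n. \<gamma> j * a j i) (f l) = 0" for l
    using g(2) by (simp add: ip_def)
  then have "(\<Sum>j\<le>n. \<gamma> j * ip n (a j) (f l)) = 0" for l
    by (simp add: ip_sum_left)
  then have *: "\<gamma> n * ip n x (f l) + (\<Sum>j<n. \<gamma> j * ip n (u j) (f l)) = 0" for l
    by (simp add: lessThan_Suc_atMost[symmetric] a_def add.commute)
  have l: "\<gamma> l = - \<gamma> n * ip n x (f l)" if "l < n" for l
  proof -
    have "(\<Sum>j<n. \<gamma> j * ip n (u j) (f l)) = (\<Sum>j<n. if j = l then \<gamma> j else 0)"
      using that by (intro sum.cong) (auto simp: uf)
    with *[of l] that show ?thesis by simp
  qed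
  then have nz: "\<gamma> n \<noteq> 0" using g(1) by (auto simp: le_less)
  have "\<gamma> n * x i + (\<Sum>j<n. \<gamma> j * u j i) = 0"
    using g(2)[OF i] by (simp add: lessThan_Suc_atMost[symmetric] a_def)
  moreover have "(\<Sum>j<n. \<gamma> j * u j i) = - \<gamma> n * (\<Sum>l<n. ip n x (f l) * u l i)"
    unfolding sum_distrib_left by (intro sum.cong) (auto simp: l)
  ultimately have "\<gamma> n * (x i - (\<Sum>l<n. ip n x (f l) * u l i)) = 0"
    by (simp add: algebra_simps)
  with nz show ?thesis by simp
qed

lemma biorthogonal_ip_expansion:
  assumes bi: "biorthogonal n n u f"
  shows "ip n a y = (\<Sum>l<n. ip n a (f l) * ip n (u l) y)"
proof -
  have "ip n a y = ip n (\<lambda>i. \<Sum>l<n. ip n a (f l) * u l i) y"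
    by (rule ip_cong_left) (rule biorthogonal_expansion[OF bi])
  then show ?thesis by (simp add: ip_sum_left)
qed

definition col_det :: "nat \<Rightarrow> (nat \<Rightarrow> nat \<Rightarrow> real) \<Rightarrow> real" where
  "col_det n u = Determinant.det (Matrix.mat n n (\<lambda>(i, j). u j i))"

lemma col_det_replace:
  assumes k: "k < n" and x: "\<And>i. i < n \<Longrightarrow> x i = (\<Sum>l<n. t l * u l i)"
  shows "col_det n (u(k := x)) = t k * col_det n u"
proof -
  let ?A = "Matrix.mat n n (\<lambda>(i, j). u j i)"
  have "Determinant.det (replace_col ?A (?A *\<^sub>v Matrix.vec n t) k) = vec_index (Matrix.vec n t) k * Determinant.det ?A"
    by (rule cramer_lemma_mat) (use k in auto)
  moreover have "replace_col ?A (?A *\<^sub>v Matrix.vec n t) k = Matrix.mat n n (\<lambda>(i, j). (u(k := x)) j i)"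
    by (rule eq_matI) (auto simp: replace_col_def scalar_prod_def x lessThan_atLeast0 mult.commute)
  ultimately show ?thesis using k by (simp add: col_det_def)
qed

lemma col_det_nonzero:
  assumes bi: "biorthogonal n n u f"
  shows "col_det n u \<noteq> 0"
proof -
  let ?A = "Matrix.mat n n (\<lambda>(i, j). u j i)" and ?B = "Matrix.mat n n (\<lambda>(i, j). f i j)"
  have "?B * ?A = 1\<^sub>m n"
    using bi by (intro eq_matI)
      (auto simp: scalar_prod_def biorthogonal_def ip_def lessThan_atLeast0 mult.commute)
  then have "Determinant.det ?B * Determinant.det ?A = 1"
    using det_mult[of ?B n ?A] by simp
  then show ?thesis by (auto simp: col_det_def)
qed

text \<open>
  The crude Leibniz bound; its only purpose is that the determinants of bounded systems have a
  finite supremum.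
\<close>

lemma col_det_bound:
  assumes "\<And>j i. j < n \<Longrightarrow> i < n \<Longrightarrow> \<bar>u j i\<bar> \<le> M"
  shows "\<bar>col_det n u\<bar> \<le> (\<Sum>p | p permutes {0..<n}. M ^ n)"
proof -
  have "\<bar>signof p * (\<Prod>i = 0..<n. u (p i) i)\<bar> \<le> M ^ n" if p: "p permutes {0..<n}" for p
  proof -
    have "\<bar>signof p :: real\<bar> = 1" by (simp add: sign_def)
    then have "\<bar>signof p * (\<Prod>i = 0..<n. u (p i) i)\<bar> = (\<Prod>i = 0..<n. \<bar>u (p i) i\<bar>)"
      by (simp add: abs_mult abs_prod)
    also have "\<dots> \<le> (\<Prod>i = 0..<n. M)"
      using assms permutes_in_image[OF p] by (intro prod_mono) auto
    finally show ?thesis by simp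
  qed
  moreover have "col_det n u = (\<Sum>p | p permutes {0..<n}. signof p * (\<Prod>i = 0..<n. u (p i) i))"
  proof -
    have "col_det n u = (\<Sum>p | p permutes {0..<n}. signof p *
        (\<Prod>i = 0..<n. Matrix.mat n n (\<lambda>(i, j). u j i) $$ (i, p i)))"
      unfolding col_det_def by (rule det_def') simp
    also have "\<dots> = (\<Sum>p | p permutes {0..<n}. signof p * (\<Prod>i = 0..<n. u (p i) i))"
      by (intro sum.cong refl arg_cong2[of _ _ _ _ "(*)"] prod.cong)
        (auto dest: permutes_in_image)
    finally show ?thesis .
  qed
  ultimately show ?thesis
    by (simp only:) (rule order_trans[OF sum_abs sum_mono], simp)
qed

text \<open>
  An approximate form of Auerbach's lemma. As \<open>X\<close> may fail to be closed, the supremum of the absolute values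
  of the determinants may not be attained; a determinant within the factor \<open>\<rho>\<close> of it suffices.
  If a coordinate of some \<open>a \<in> X\<close> exceeded \<open>\<rho>\<close>, then replacing the corresponding basis vector by \<open>a\<close>
  would multiply the determinant by more than \<open>\<rho>\<close> and push it above the supremum.
\<close>

lemma auerbach_system:
  fixes X :: "(nat \<Rightarrow> real) set"
  assumes span: "\<And>v. \<exists>i<n. v i \<noteq> 0 \<Longrightarrow> \<exists>a\<in>X. ip n a v \<noteq> 0"
    and bounded: "\<And>a i. a \<in> X \<Longrightarrow> i < n \<Longrightarrow> \<bar>a i\<bar> \<le> M" and \<rho>: "\<rho> > 1"
  obtains u f where "\<And>j. j < n \<Longrightarrow> u j \<in> X" "biorthogonal n n u f"
    "\<And>a l. a \<in> X \<Longrightarrow> l < n \<Longrightarrow> \<bar>ip n a (f l)\<bar> \<le> \<rho>"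
proof -
  define S where "S = {\<bar>col_det n u\<bar> |u f. (\<forall>j<n. u j \<in> X) \<and> biorthogonal n n u f}"
  define s where "s = Sup S"
  have bdd: "bdd_above S"
    unfolding S_def
    by (rule bdd_aboveI[of _ "\<Sum>p | p permutes {0..<n}. M ^ n"])
      (use col_det_bound bounded in blast)
  obtain u0 f0 where u0: "\<forall>j<n. u0 j \<in> X" "biorthogonal n n u0 f0"
    using biorthogonal_exists[OF span order.refl] by blast
  have "\<bar>col_det n u0\<bar> \<in> S" using u0 by (auto simp: S_def)
  then have "S \<noteq> {}" and "\<bar>col_det n u0\<bar> \<le> s"
    using cSup_upper[OF _ bdd] by (auto simp: s_def)
  then have "0 < s" using col_det_nonzero[OF u0(2)] by linarith
  then have "s / \<rho> < s" using \<rho> by (simp add: divide_simps)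
  then obtain t where "t \<in> S" "s / \<rho> < t"
    using \<open>S \<noteq> {}\<close> less_cSup_iff[OF _ bdd] unfolding s_def by blast
  then obtain u f where u: "\<And>j. j < n \<Longrightarrow> u j \<in> X" and bi: "biorthogonal n n u f"
    and large: "s / \<rho> < \<bar>col_det n u\<bar>"
    by (auto simp: S_def)
  have "\<bar>ip n a (f l)\<bar> \<le> \<rho>" if a: "a \<in> X" and l: "l < n" for a l
  proof (rule ccontr)
    assume "\<not> \<bar>ip n a (f l)\<bar> \<le> \<rho>"
    then have big: "\<rho> < \<bar>ip n a (f l)\<bar>" by simp
    define c where "c = ip n a (f l)"
    have c: "c \<noteq> 0" "\<rho> < \<bar>c\<bar>" using big \<rho> by (auto simp: c_def)
    \<comment> \<open>\<open>h\<close> is the dual system after the exchange of \<open>u l\<close> for \<open>a\<close>.\<close>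
    define g where "g i = f l i / c" for i
    have g: "ip n b g = ip n b (f l) / c" for b
      unfolding g_def ip_def by (simp add: sum_divide_distrib)
    define h where "h = (\<lambda>m i. f m i - ip n a (f m) * g i)(l := g)"
    have h: "ip n b (h m) = (if m = l then ip n b g else ip n b (f m) - ip n a (f m) * ip n b g)" for b m
      unfolding h_def by (auto simp: ip_diff ip_scale)
    have "biorthogonal n n (u(l := a)) h"
      unfolding biorthogonal_def h g using bi c l
      by (auto simp: biorthogonal_def c_def[symmetric])
    moreover have "\<forall>j<n. (u(l := a)) j \<in> X" using u a by auto
    ultimately have "\<bar>col_det n (u(l := a))\<bar> \<in> S" by (auto simp: S_def)
    then have le: "\<bar>col_det n (u(l := a))\<bar> \<le> s" unfolding s_def by (rule cSup_upper[OF _ bdd])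
    have "col_det n (u(l := a)) = c * col_det n u"
      unfolding c_def by (rule col_det_replace[OF l]) (rule biorthogonal_expansion[OF bi])
    with le have "\<bar>c\<bar> * \<bar>col_det n u\<bar> \<le> s" by (simp add: abs_mult)
    moreover have "\<rho> * (s / \<rho>) < \<bar>c\<bar> * \<bar>col_det n u\<bar>"
      using c large \<open>0 < s\<close> \<rho> by (intro mult_strict_mono) auto
    ultimately show False using \<rho> by simp
  qed
  with u bi show thesis by (rule that)
qed

section \<open>Separation and convex combinations\<close>

text \<open>
  The proof is an elimination of coordinates, in the manner of Fourier and Motzkin: the slice \<open>x n = 0\<close> is
  separated by induction, and the last coefficient \<open>s\<close> has to lie above all the quotients coming from points
  with \<open>x n > 0\<close> and below all those coming from points with \<open>x n < 0\<close>. Such an \<open>s\<close> exists since the segment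
  from a point of the one kind to a point of the other meets the slice.
\<close>

lemma weak_separation:
  fixes C :: "(nat \<Rightarrow> real) set"
  assumes "C \<noteq> {}"
    and "\<And>x y u v. x \<in> C \<Longrightarrow> y \<in> C \<Longrightarrow> 0 \<le> u \<Longrightarrow> 0 \<le> v \<Longrightarrow> u + v = 1 \<Longrightarrow>
      \<exists>z\<in>C. \<forall>i<n. z i = u * x i + v * y i"
    and "\<And>x. x \<in> C \<Longrightarrow> \<exists>i<n. x i \<noteq> 0"
  shows "\<exists>a. (\<exists>i<n. a i \<noteq> 0) \<and> (\<forall>x\<in>C. 0 \<le> ip n a x)"
  using assms
proof (induction n arbitrary: C)
  case 0
  then show ?case by auto
next
  case (Suc n)
  note convex = Suc.prems(2)
  define P where "P = {x \<in> C. 0 < x n}"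
  define N where "N = {x \<in> C. x n < 0}"
  define Z where "Z = {x \<in> C. x n = 0}"
  have slice: "\<exists>z\<in>Z. \<forall>i<n. z i = (- y n / (x n - y n)) * x i + (x n / (x n - y n)) * y i"
    if "x \<in> P" "y \<in> N" for x y
  proof -
    have xy: "x \<in> C" "y \<in> C" "0 < x n" "y n < 0" using that by (auto simp: P_def N_def)
    obtain z where z: "z \<in> C" "\<forall>i<Suc n. z i = (- y n / (x n - y n)) * x i + (x n / (x n - y n)) * y i"
      using convex[of x y "- y n / (x n - y n)" "x n / (x n - y n)"] xy
      by (auto simp: divide_simps)
    then have "z n = 0" by simp
    with z show ?thesis by (auto simp: Z_def intro!: bexI[of _ z])
  qed
  have unit: "ip (Suc n) (\<lambda>i. if i = n then s else 0) x = s * x n" for s x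
    by (simp add: ip_def)
  consider "N = {}" | "P = {}" | "N \<noteq> {}" "P \<noteq> {}" by blast
  then show ?case
  proof cases
    case 1
    then show ?thesis
      by (intro exI[of _ "\<lambda>i. if i = n then 1 else 0"]) (auto simp: unit N_def not_less)
  next
    case 2
    then show ?thesis
      by (intro exI[of _ "\<lambda>i. if i = n then - 1 else 0"]) (auto simp: unit P_def not_less)
  next
    case 3
    then have "Z \<noteq> {}" using slice by blast
    moreover have "\<exists>w\<in>Z. \<forall>i<n. w i = u * x i + v * y i"
      if "x \<in> Z" "y \<in> Z" "0 \<le> u" "0 \<le> v" "u + v = 1" for x y u v
      using convex[of x y u v] that by (force simp: Z_def)
    moreover have "\<exists>i<n. x i \<noteq> 0" if "x \<in> Z" for x
      using Suc.prems(3)[of x] that by (auto simp: Z_def less_Suc_eq)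
    ultimately obtain a where a: "\<exists>i<n. a i \<noteq> 0" "\<And>z. z \<in> Z \<Longrightarrow> 0 \<le> ip n a z"
      using Suc.IH[of Z] by blast
    have key: "- ip n a x / x n \<le> ip n a y / - y n" if "x \<in> P" "y \<in> N" for x y
    proof -
      have xy: "0 < x n" "y n < 0" using that by (auto simp: P_def N_def)
      obtain z where z: "z \<in> Z" "\<forall>i<n. z i = (- y n / (x n - y n)) * x i + (x n / (x n - y n)) * y i"
        using slice[OF \<open>x \<in> P\<close> \<open>y \<in> N\<close>] by blast
      have "ip n a z = ip n a (\<lambda>i. (- y n / (x n - y n)) * x i + (x n / (x n - y n)) * y i)"
        using z by (intro ip_cong) auto
      also have "\<dots> = (- y n * ip n a x + x n * ip n a y) / (x n - y n)"
        unfolding ip_add ip_scale by (simp add: add_divide_distrib diff_divide_distrib)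
      finally have "0 \<le> - y n * ip n a x + x n * ip n a y"
        using a(2)[OF z(1)] xy by (simp add: zero_le_divide_iff)
      with xy show ?thesis by (simp add: divide_simps algebra_simps)
    qed
    define s where "s = (SUP x\<in>P. - ip n a x / x n)"
    obtain y0 where "y0 \<in> N" using 3 by blast
    then have "bdd_above ((\<lambda>x. - ip n a x / x n) ` P)"
      using key by (intro bdd_aboveI2[of _ _ "ip n a y0 / - y0 n"]) auto
    then have lower: "- ip n a x / x n \<le> s" if "x \<in> P" for x
      unfolding s_def using that by (rule cSUP_upper2) simp
    have upper: "s \<le> ip n a y / - y n" if "y \<in> N" for y
      unfolding s_def using 3 key that by (intro cSUP_least) auto
    define b where "b = a(n := s)"
    have b: "ip (Suc n) b x = ip n a x + s * x n" for x
      by (simp add: ip_def b_def)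
    have "0 \<le> ip (Suc n) b x" if x: "x \<in> C" for x
    proof -
      consider "x \<in> P" | "x \<in> N" | "x \<in> Z"
        using x unfolding P_def N_def Z_def by (cases "x n" "0::real" rule: linorder_cases) auto
      then show ?thesis
      proof cases
        case 1
        then have "0 < x n" by (simp add: P_def)
        with lower[OF 1] show ?thesis by (simp add: b divide_simps algebra_simps)
      next
        case 2
        then have "x n < 0" by (simp add: N_def)
        with upper[OF 2] show ?thesis by (simp add: b divide_simps algebra_simps)
      next
        case 3
        then have "x n = 0" by (simp add: Z_def)
        with a(2)[OF 3] show ?thesis by (simp add: b)
      qed
    qed
    moreover have "\<exists>i<Suc n. b i \<noteq> 0" using a(1) by (auto simp: b_def less_Suc_eq)
    ultimately show ?thesis by blast
  qed
qed

text \<open>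
  The convex hull of \<open>X\<close> and the origin.
\<close>

definition subconvex_hull :: "nat \<Rightarrow> (nat \<Rightarrow> real) set \<Rightarrow> (nat \<Rightarrow> real) set" where
  "subconvex_hull n X = {q. \<exists>A \<mu>. finite A \<and> A \<subseteq> X \<and> (\<forall>a\<in>A. 0 \<le> \<mu> a) \<and> sum \<mu> A \<le> 1 \<and>
     (\<forall>i<n. q i = (\<Sum>a\<in>A. \<mu> a * a i))}"

text \<open>
  Since the weights only have to add up to at most 1, a linear dependency (and not merely an affine
  one) can be used to remove a vector, provided it is subtracted in the direction that does not increase the
  total weight. This gives \<open>n\<close> vectors where the usual theorem gives \<open>n + 1\<close>.
\<close>

lemma subconvex_hull_caratheodory:
  assumes "q \<in> subconvex_hull n X"
  obtains A \<mu> where "finite A" "A \<subseteq> X" "card A \<le> n" "\<And>a. a \<in> A \<Longrightarrow> 0 \<le> \<mu> a" "sum \<mu> A \<le> 1"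
    "\<And>i. i < n \<Longrightarrow> q i = (\<Sum>a\<in>A. \<mu> a * a i)"
proof -
  define R where "R A \<mu> \<longleftrightarrow> finite A \<and> A \<subseteq> X \<and> (\<forall>a\<in>A. 0 \<le> \<mu> a) \<and> sum \<mu> A \<le> 1 \<and>
     (\<forall>i<n. q i = (\<Sum>a\<in>A. \<mu> a * a i))" for A and \<mu> :: "(nat \<Rightarrow> real) \<Rightarrow> real"
  have "\<exists>A. \<exists>\<mu>. R A \<mu>" using assms unfolding subconvex_hull_def R_def by blast
  then obtain A where A: "\<exists>\<mu>. R A \<mu>" and least: "\<And>B. \<exists>\<mu>. R B \<mu> \<Longrightarrow> card A \<le> card B"
    using ex_has_least_nat[of "\<lambda>A. \<exists>\<mu>. R A \<mu>" _ card] by blast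
  then obtain \<mu> where \<mu>: "R A \<mu>" by blast
  then have fin: "finite A" by (simp add: R_def)
  have "card A \<le> n"
  proof (rule ccontr)
    assume "\<not> card A \<le> n"
    then obtain \<gamma>' where g': "\<exists>a\<in>A. \<gamma>' a \<noteq> 0" "\<And>i. i < n \<Longrightarrow> (\<Sum>a\<in>A. \<gamma>' a * a i) = 0"
      using linear_dependency[OF fin, of n "\<lambda>a. a"] by auto
    \<comment> \<open>Up to a sign, the dependency has a nonnegative sum and a positive coefficient.\<close>
    obtain \<gamma> where g: "\<exists>a\<in>A. 0 < \<gamma> a" "0 \<le> sum \<gamma> A" "\<And>i. i < n \<Longrightarrow> (\<Sum>a\<in>A. \<gamma> a * a i) = 0"
    proof (cases "0 < sum \<gamma>' A \<or> sum \<gamma>' A = 0 \<and> (\<exists>a\<in>A. 0 < \<gamma>' a)")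
      case True
      then have "\<exists>a\<in>A. 0 < \<gamma>' a" using sum_nonpos[of A \<gamma>'] by (meson not_less)
      with True g' show ?thesis by (intro that[of \<gamma>']) auto
    next
      case False
      then have "sum \<gamma>' A \<le> 0" "\<exists>a\<in>A. \<gamma>' a < 0"
        using g'(1) sum_nonneg[of A \<gamma>'] by (force simp: not_less)+
      with g'(2) show ?thesis
        by (intro that[of "\<lambda>a. - \<gamma>' a"]) (auto simp: sum_negf)
    qed
    \<comment> \<open>Subtract the largest multiple \<open>t\<close> of \<open>\<gamma>\<close> that keeps all weights nonnegative; it cancels the weight of \<open>k\<close>.\<close>
    define S where "S = {a \<in> A. 0 < \<gamma> a}"
    have S: "finite S" "S \<noteq> {}" using g(1) fin by (auto simp: S_def)
    define k where "k = arg_min_on (\<lambda>a. \<mu> a / \<gamma> a) S"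
    have k: "k \<in> S" unfolding k_def by (rule arg_min_if_finite[OF S])
    have kmin: "\<mu> k / \<gamma> k \<le> \<mu> a / \<gamma> a" if "a \<in> S" for a
      unfolding k_def by (rule arg_min_least[OF S that])
    define t where "t = \<mu> k / \<gamma> k"
    define \<nu> where "\<nu> a = \<mu> a - t * \<gamma> a" for a
    have kA: "k \<in> A" "0 < \<gamma> k" using k by (auto simp: S_def)
    have t: "0 \<le> t" using kA \<mu> by (auto simp: t_def R_def)
    have \<nu>k: "\<nu> k = 0" using kA by (simp add: \<nu>_def t_def)
    have pos: "0 \<le> \<nu> a" if "a \<in> A" for a
    proof (cases "a \<in> S")
      case True
      then show ?thesis using kmin[OF True] by (simp add: \<nu>_def t_def[symmetric] S_def pos_le_divide_eq)
    next
      case False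
      then have "t * \<gamma> a \<le> 0" using t that by (auto simp: S_def mult_le_0_iff)
      then show ?thesis using \<mu> that by (force simp: \<nu>_def R_def)
    qed
    have drop: "(\<Sum>a\<in>A - {k}. \<nu> a * h a) = (\<Sum>a\<in>A. \<nu> a * h a)" for h :: "(nat \<Rightarrow> real) \<Rightarrow> real"
      using fin \<nu>k by (intro sum.mono_neutral_left) auto
    have "sum \<nu> A = sum \<mu> A - t * sum \<gamma> A"
      by (simp add: \<nu>_def sum_subtractf sum_distrib_left)
    then have "sum \<nu> A \<le> 1" using \<mu> t g(2) by (simp add: R_def) (smt (verit) mult_nonneg_nonneg)
    moreover have "q i = (\<Sum>a\<in>A. \<nu> a * a i)" if "i < n" for i
    proof -
      have "(\<Sum>a\<in>A. \<nu> a * a i) = (\<Sum>a\<in>A. \<mu> a * a i) - t * (\<Sum>a\<in>A. \<gamma> a * a i)"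
        by (simp add: \<nu>_def algebra_simps sum_subtractf sum_distrib_left)
      with g(3)[OF that] \<mu> that show ?thesis by (simp add: R_def)
    qed
    ultimately have "R (A - {k}) \<nu>"
      using \<mu> pos drop[of "\<lambda>_. 1"] drop unfolding R_def by auto
    then have "card A \<le> card (A - {k})" using least by blast
    with kA fin show False by (metis card_Diff1_less not_less)
  qed
  with \<mu> show thesis by (intro that[of A \<mu>]) (auto simp: R_def)
qed

lemma subconvex_hull_convex:
  assumes "x \<in> subconvex_hull n X" "y \<in> subconvex_hull n X" "0 \<le> u" "0 \<le> v" "u + v = 1"
  shows "(\<lambda>i. u * x i + v * y i) \<in> subconvex_hull n X"
proof -
  obtain A \<mu> where A: "finite A" "A \<subseteq> X" "\<And>a. a \<in> A \<Longrightarrow> 0 \<le> \<mu> a" "sum \<mu> A \<le> 1"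
    "\<And>i. i < n \<Longrightarrow> x i = (\<Sum>a\<in>A. \<mu> a * a i)"
    using assms(1) unfolding subconvex_hull_def by blast
  obtain B \<nu> where B: "finite B" "B \<subseteq> X" "\<And>a. a \<in> B \<Longrightarrow> 0 \<le> \<nu> a" "sum \<nu> B \<le> 1"
    "\<And>i. i < n \<Longrightarrow> y i = (\<Sum>a\<in>B. \<nu> a * a i)"
    using assms(2) unfolding subconvex_hull_def by blast
  define \<kappa> where "\<kappa> a = u * (if a \<in> A then \<mu> a else 0) + v * (if a \<in> B then \<nu> a else 0)" for a
  have split: "(\<Sum>a\<in>A \<union> B. \<kappa> a * h a) = u * (\<Sum>a\<in>A. \<mu> a * h a) + v * (\<Sum>a\<in>B. \<nu> a * h a)"
    for h :: "(nat \<Rightarrow> real) \<Rightarrow> real"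
  proof -
    have "(\<Sum>a\<in>A \<union> B. \<kappa> a * h a) =
        u * (\<Sum>a\<in>A \<union> B. (if a \<in> A then \<mu> a else 0) * h a) +
        v * (\<Sum>a\<in>A \<union> B. (if a \<in> B then \<nu> a else 0) * h a)"
      by (simp add: \<kappa>_def algebra_simps sum.distrib sum_distrib_left)
    also have "(\<Sum>a\<in>A \<union> B. (if a \<in> A then \<mu> a else 0) * h a) = (\<Sum>a\<in>A. \<mu> a * h a)"
      using A(1) B(1) by (intro sum.mono_neutral_cong_right) auto
    also have "(\<Sum>a\<in>A \<union> B. (if a \<in> B then \<nu> a else 0) * h a) = (\<Sum>a\<in>B. \<nu> a * h a)"
      using A(1) B(1) by (intro sum.mono_neutral_cong_right) auto
    finally show ?thesis .
  qed
  have "u * sum \<mu> A + v * sum \<nu> B \<le> u * 1 + v * 1"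
    using A(4) B(4) assms(3,4) by (intro add_mono mult_left_mono)
  then have "sum \<kappa> (A \<union> B) \<le> 1" using split[of "\<lambda>_. 1"] assms(5) by simp
  moreover have "0 \<le> \<kappa> a" if "a \<in> A \<union> B" for a
    using that A(3) B(3) assms(3,4) by (auto simp: \<kappa>_def)
  moreover have "u * x i + v * y i = (\<Sum>a\<in>A \<union> B. \<kappa> a * a i)" if "i < n" for i
    using A(5)[OF that] B(5)[OF that] split[of "\<lambda>a. a i"] by simp
  ultimately show ?thesis
    unfolding subconvex_hull_def using A(1,2) B(1,2)
    by (intro CollectI exI[of _ "A \<union> B"] exI[of _ \<kappa>]) auto
qed

lemma subconvex_hull_separation:
  assumes "w \<notin> subconvex_hull n X"
  obtains y where "\<exists>i<n. y i \<noteq> 0" "ip n w y \<ge> 0" "\<And>a. a \<in> X \<Longrightarrow> ip n a y \<le> ip n w y"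
proof -
  let ?Q = "subconvex_hull n X"
  define C where "C = {(\<lambda>i. w i - q i) |q. q \<in> ?Q}"
  have zero: "(\<lambda>_. 0) \<in> ?Q" unfolding subconvex_hull_def by (auto intro!: exI[of _ "{}"])
  have sub: "a \<in> ?Q" if "a \<in> X" for a
    unfolding subconvex_hull_def using that
    by (intro CollectI exI[of _ "{a}"] exI[of _ "\<lambda>_. 1"]) auto
  have "\<exists>a. (\<exists>i<n. a i \<noteq> 0) \<and> (\<forall>x\<in>C. 0 \<le> ip n a x)"
  proof (rule weak_separation)
    show "C \<noteq> {}" using zero by (auto simp: C_def)
  next
    fix x y u v assume xy: "x \<in> C" "y \<in> C" and uv: "0 \<le> u" "0 \<le> v" "u + v = (1::real)"
    obtain p q where pq: "p \<in> ?Q" "q \<in> ?Q" "x = (\<lambda>i. w i - p i)" "y = (\<lambda>i. w i - q i)"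
      using xy by (auto simp: C_def)
    have "u * x i + v * y i = (u + v) * w i - (u * p i + v * q i)" for i
      using pq(3,4) by (simp add: algebra_simps)
    then show "\<exists>z\<in>C. \<forall>i<n. z i = u * x i + v * y i"
      using subconvex_hull_convex[OF pq(1,2) uv] uv
      by (intro bexI[of _ "\<lambda>i. w i - (u * p i + v * q i)"]) (auto simp: C_def)
  next
    fix x assume "x \<in> C"
    then obtain q where q: "q \<in> ?Q" "x = (\<lambda>i. w i - q i)" by (auto simp: C_def)
    have "w \<in> ?Q" if "\<And>i. i < n \<Longrightarrow> w i = q i"
      using q(1) by (simp add: subconvex_hull_def that)
    with assms q(2) show "\<exists>i<n. x i \<noteq> 0" by fastforce
  qed
  then obtain y where y: "\<exists>i<n. y i \<noteq> 0" "\<And>x. x \<in> C \<Longrightarrow> 0 \<le> ip n y x" by blast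
  have le: "ip n q y \<le> ip n w y" if "q \<in> ?Q" for q
    using y(2)[of "\<lambda>i. w i - q i"] that by (auto simp: C_def ip_diff ip_commute)
  show thesis
    by (rule that[OF y(1)]) (use le[OF zero] le sub in \<open>auto simp: ip_def\<close>)
qed

text \<open>
  The cube turns the weak separation at \<open>y\<close> into one that is strict at \<open>c\<close>: the functional has to be positive
  somewhere on the cube around \<open>c\<close>, so its value at \<open>y - c\<close> is positive and can be scaled to 1.
\<close>

lemma convex_in_separation:
  assumes K: "convex_in n K" and cube: "\<And>x. x \<in> Rd n \<Longrightarrow> (\<And>i. i < n \<Longrightarrow> \<bar>x i - c i\<bar> \<le> r) \<Longrightarrow> x \<in> K"
    and c: "c \<in> Rd n" and r: "0 < r" and y: "y \<in> Rd n" "y \<notin> K"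
  obtains a where "\<And>x. x \<in> K \<Longrightarrow> ip n a (\<lambda>i. x i - c i) \<le> 1" "1 \<le> ip n a (\<lambda>i. y i - c i)"
proof -
  define C where "C = {(\<lambda>i. y i - x i) |x. x \<in> K}"
  have cK: "c \<in> K" using cube[OF c] r by simp
  have KR: "K \<subseteq> Rd n" using K by (simp add: convex_in_def)
  have "\<exists>a. (\<exists>i<n. a i \<noteq> 0) \<and> (\<forall>x\<in>C. 0 \<le> ip n a x)"
  proof (rule weak_separation)
    show "C \<noteq> {}" using cK by (auto simp: C_def)
  next
    fix x x' u v assume xx: "x \<in> C" "x' \<in> C" and uv: "0 \<le> u" "0 \<le> v" "u + v = (1::real)"
    obtain p q where pq: "p \<in> K" "q \<in> K" "x = (\<lambda>i. y i - p i)" "x' = (\<lambda>i. y i - q i)"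
      using xx by (auto simp: C_def)
    have *: "u * x i + v * x' i = (u + v) * y i - (u * p i + v * q i)" for i
      using pq(3,4) by (simp add: algebra_simps)
    have "(\<lambda>i\<in>{..<n}. u * p i + v * q i) \<in> K" using K pq uv by (simp add: convex_in_def)
    then show "\<exists>z\<in>C. \<forall>i<n. z i = u * x i + v * x' i"
      using uv unfolding C_def *
      by (intro bexI[of _ "\<lambda>i. y i - (\<lambda>i\<in>{..<n}. u * p i + v * q i) i"] CollectI exI conjI refl) auto
  next
    fix x assume "x \<in> C"
    then obtain q where q: "q \<in> K" "x = (\<lambda>i. y i - q i)" by (auto simp: C_def)
    have "y = q" if "\<And>i. i < n \<Longrightarrow> y i = q i"
      using y(1) q(1) KR that by (intro PiE_ext[of _ "{..<n}" "\<lambda>_. UNIV"]) (auto simp: Rd_def)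
    with y q show "\<exists>i<n. x i \<noteq> 0" by force
  qed
  then obtain b where b: "\<exists>i<n. b i \<noteq> 0" "\<And>x. x \<in> C \<Longrightarrow> 0 \<le> ip n b x" by blast
  have le: "ip n b (\<lambda>i. x i - c i) \<le> ip n b (\<lambda>i. y i - c i)" if "x \<in> K" for x
    using b(2)[of "\<lambda>i. y i - x i"] that by (auto simp: C_def ip_diff)
  obtain k where k: "k < n" "b k \<noteq> 0" using b(1) by blast
  define x where "x = c(k := c k + r * sgn (b k))"
  have "x \<in> K"
    using c k r by (intro cube) (auto simp: x_def Rd_def PiE_def extensional_def sgn_real_def)
  have "ip n b (\<lambda>i. x i - c i) = (\<Sum>i<n. if i = k then b k * (r * sgn (b k)) else 0)"
    unfolding ip_def by (intro sum.cong) (auto simp: x_def)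
  also have "\<dots> = r * \<bar>b k\<bar>" using k by (simp add: abs_sgn)
  finally have "0 < ip n b (\<lambda>i. x i - c i)" using k r by simp
  then have h: "0 < ip n b (\<lambda>i. y i - c i)" (is "0 < ?h") using le[OF \<open>x \<in> K\<close>] by linarith
  show thesis
  proof (rule that[of "\<lambda>i. inverse ?h * b i"])
    show "ip n (\<lambda>i. inverse ?h * b i) (\<lambda>i. x i - c i) \<le> 1" if "x \<in> K" for x
      unfolding ip_scale_left using le[OF that] h by (simp add: field_simps)
    show "1 \<le> ip n (\<lambda>i. inverse ?h * b i) (\<lambda>i. y i - c i)"
      unfolding ip_scale_left using h by simp
  qed
qed

section \<open>Volume of cubes, hyperplanes and homothetic images\<close>

abbreviation borel_Rd :: "nat \<Rightarrow> (nat \<Rightarrow> real) measure" where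
  "borel_Rd d \<equiv> \<Pi>\<^sub>M i\<in>{..<d}. (lborel :: real measure)"

interpretation lborel_product: product_sigma_finite "\<lambda>_ :: nat. lborel :: real measure"
  by standard

lemma space_borel_Rd: "space (borel_Rd d) = Rd d"
  by (simp add: space_PiM Rd_def)

lemma vol_eq: "A \<in> sets (borel_Rd d) \<Longrightarrow> vol d A = emeasure (borel_Rd d) A"
  by (simp add: vol_def main_part_sets)

lemma sets_vol: "A \<in> sets (borel_Rd d) \<Longrightarrow> A \<in> sets (completion (borel_Rd d))"
  by simp

lemma ip_measurable [measurable]: "ip d a \<in> borel_measurable (borel_Rd d)"
proof -
  have "(\<lambda>x. \<Sum>i<d. a i * x i) \<in> borel_measurable (borel_Rd d)"
    by (intro borel_measurable_sum borel_measurable_times borel_measurable_const)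
      (simp add: measurable_component_singleton)
  then show ?thesis by (simp add: ip_def[abs_def])
qed

definition cube :: "nat \<Rightarrow> (nat \<Rightarrow> real) \<Rightarrow> real \<Rightarrow> (nat \<Rightarrow> real) set" where
  "cube d c r = {x \<in> Rd d. \<forall>i<d. \<bar>x i - c i\<bar> \<le> r}"

lemma cube_eq: "cube d c r = (\<Pi>\<^sub>E i\<in>{..<d}. {c i - r..c i + r})"
proof -
  have *: "\<bar>x i - c i\<bar> \<le> r \<longleftrightarrow> x i \<in> {c i - r..c i + r}" for x i
    by (simp only: abs_diff_le_iff atLeastAtMost_iff)
  show ?thesis
    by (intro Set.set_eqI) (simp add: cube_def Rd_def PiE_iff Ball_def conj_commute * del: atLeastAtMost_iff)
qed

lemma cube_sets: "cube d c r \<in> sets (borel_Rd d)"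
  unfolding cube_eq by (intro sets_PiM_I_finite) auto

lemma vol_cube:
  assumes "0 \<le> r"
  shows "vol d (cube d c r) = ennreal ((2 * r) ^ d)"
proof -
  have "vol d (cube d c r) = (\<Prod>i<d. emeasure lborel {c i - r..c i + r})"
    unfolding vol_eq[OF cube_sets] unfolding cube_eq
    by (rule lborel_product.emeasure_PiM) auto
  also have "\<dots> = (\<Prod>i<d. ennreal (2 * r))" using assms by simp
  finally show ?thesis using assms by (simp add: ennreal_power)
qed

text \<open>
  By Fubini, integrating first along a coordinate with \<open>a k \<noteq> 0\<close>: on every line in that direction the
  hyperplane has a single point.
\<close>

lemma vol_hyperplane:
  assumes k: "k < d" "a k \<noteq> 0"
  shows "vol d {x \<in> Rd d. ip d a x = t} = 0"
proof -
  let ?H = "{x \<in> Rd d. ip d a x = t}"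
  let ?I = "{..<d} - {k}"
  have ins: "insert k ?I = {..<d}" using k by auto
  have H: "?H \<in> sets (borel_Rd d)"
    unfolding space_borel_Rd[symmetric] by measurable
  have zero: "(\<integral>\<^sup>+ y. indicator ?H (x(k := y)) \<partial>lborel) = 0" for x
  proof -
    define y0 where "y0 = (t - (\<Sum>i\<in>?I. a i * x i)) / a k"
    have "ip d a (x(k := y)) = a k * y + (\<Sum>i\<in>?I. a i * x i)" for y
    proof -
      have "ip d a (x(k := y)) = a k * y + (\<Sum>i\<in>?I. a i * (x(k := y)) i)"
        unfolding ip_def using k by (subst sum.remove[of _ k]) auto
      also have "(\<Sum>i\<in>?I. a i * (x(k := y)) i) = (\<Sum>i\<in>?I. a i * x i)"
        by (intro sum.cong) auto
      finally show ?thesis .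
    qed
    then have "indicator ?H (x(k := y)) \<le> (indicator {y0} y :: ennreal)" for y
      using k by (auto simp: indicator_def y0_def field_simps)
    then have "(\<integral>\<^sup>+ y. indicator ?H (x(k := y)) \<partial>lborel) \<le> (\<integral>\<^sup>+ y. indicator {y0} y \<partial>lborel)"
      by (intro nn_integral_mono)
    also have "\<dots> = emeasure lborel {y0}" by (subst nn_integral_indicator) auto
    finally show ?thesis by simp
  qed
  have "vol d ?H = (\<integral>\<^sup>+ x. indicator ?H x \<partial>borel_Rd d)"
    unfolding vol_eq[OF H] using H by simp
  also have "\<dots> = (\<integral>\<^sup>+ x. indicator ?H x \<partial>(\<Pi>\<^sub>M i\<in>insert k ?I. lborel))"
    by (simp only: ins)
  also have "\<dots> = (\<integral>\<^sup>+ x. (\<integral>\<^sup>+ y. indicator ?H (x(k := y)) \<partial>lborel) \<partial>(\<Pi>\<^sub>M i\<in>?I. lborel))"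
    by (rule lborel_product.product_nn_integral_insert)
      (use H in \<open>simp_all only: ins, auto intro!: borel_measurable_indicator\<close>)
  finally show ?thesis by (simp add: zero)
qed

definition affine_map :: "nat \<Rightarrow> (nat \<Rightarrow> real) \<Rightarrow> real \<Rightarrow> (nat \<Rightarrow> real) \<Rightarrow> nat \<Rightarrow> real" where
  "affine_map d b k z = (\<lambda>i\<in>{..<d}. b i + k * z i)"

lemma affine_map_measurable: "affine_map d b k \<in> borel_Rd d \<rightarrow>\<^sub>M borel_Rd d"
  unfolding affine_map_def[abs_def]
  by (intro measurable_restrict) (simp add: measurable_component_singleton borel_measurable_add borel_measurable_times)

text \<open>
  Measures on the product space are determined by their values on boxes, and on boxes the claim is the
  one-dimensional change of variables in each factor.
\<close>

lemma vol_homothety: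
  assumes k: "k \<noteq> 0" and A: "A \<in> sets (borel_Rd d)"
  shows "vol d {z \<in> Rd d. affine_map d b k z \<in> A} * ennreal (\<bar>k\<bar> ^ d) = vol d A"
proof -
  let ?M = "borel_Rd d"
  let ?T = "affine_map d b k"
  note T = affine_map_measurable[of d b k]
  define P where "P = density (distr ?M ?M ?T) (\<lambda>_. ennreal (\<bar>k\<bar> ^ d))"
  have P: "emeasure P B = emeasure ?M (?T -` B \<inter> Rd d) * ennreal (\<bar>k\<bar> ^ d)" if "B \<in> sets ?M" for B
    using that T by (simp add: P_def emeasure_density_const emeasure_distr
        space_borel_Rd mult.commute)
  have "P = ?M"
  proof (rule lborel_product.PiM_eqI)
    fix B :: "nat \<Rightarrow> real set" assume B: "\<And>i. i \<in> {..<d} \<Longrightarrow> B i \<in> sets lborel"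
    let ?B = "\<lambda>i. (\<lambda>y. b i + k * y) -` B i"
    have meas: "?B i \<in> sets lborel" if "i < d" for i
    proof -
      have "(\<lambda>y. b i + k * y) \<in> borel_measurable lborel" by simp
      from measurable_sets[OF this, of "B i"] B[of i] that show ?thesis by simp
    qed
    have line: "emeasure lborel (?B i) * ennreal \<bar>k\<bar> = emeasure lborel (B i)" if "i < d" for i
    proof -
      have "emeasure lborel (B i) =
          emeasure (density (distr lborel borel (\<lambda>x. b i + k * x)) (\<lambda>_. ennreal \<bar>k\<bar>)) (B i)"
        using lborel_real_affine[OF k, of "b i"] by simp
      also have "\<dots> = emeasure lborel (?B i) * ennreal \<bar>k\<bar>"
        using B[of i] that by (simp add: emeasure_density_const emeasure_distr mult.commute)
      finally show ?thesis by simp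
    qed
    have pre: "?T -` Pi\<^sub>E {..<d} B \<inter> Rd d = Pi\<^sub>E {..<d} ?B"
      by (auto simp: affine_map_def Rd_def PiE_def Pi_def)
    have "emeasure P (Pi\<^sub>E {..<d} B) = emeasure ?M (Pi\<^sub>E {..<d} ?B) * ennreal (\<bar>k\<bar> ^ d)"
      using B by (subst P) (auto simp: pre intro!: sets_PiM_I_finite)
    also have "emeasure ?M (Pi\<^sub>E {..<d} ?B) = (\<Prod>i<d. emeasure lborel (?B i))"
      using meas by (intro lborel_product.emeasure_PiM) auto
    also have "\<dots> * ennreal (\<bar>k\<bar> ^ d) = (\<Prod>i<d. emeasure lborel (?B i) * ennreal \<bar>k\<bar>)"
      by (simp add: prod.distrib ennreal_power)
    also have "\<dots> = (\<Prod>i<d. emeasure lborel (B i))" using line by (intro prod.cong) auto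
    finally show "emeasure P (Pi\<^sub>E {..<d} B) = (\<Prod>i<d. emeasure lborel (B i))" .
  qed (simp_all add: P_def)
  then have "emeasure ?M A = emeasure ?M (?T -` A \<inter> Rd d) * ennreal (\<bar>k\<bar> ^ d)"
    using P[OF A] by simp
  moreover have "?T -` A \<inter> Rd d \<in> sets ?M"
    using measurable_sets[OF T A] by (simp add: space_borel_Rd)
  moreover have "{z \<in> Rd d. ?T z \<in> A} = ?T -` A \<inter> Rd d" by auto
  ultimately show ?thesis using A by (simp add: vol_eq)
qed

lemma vol_homothety_preimage:
  assumes k: "k \<noteq> 0" and A: "A \<in> sets (borel_Rd d)"
  shows "vol d {z \<in> Rd d. affine_map d b k z \<in> A} = ennreal ((1 / \<bar>k\<bar>) ^ d) * vol d A"
proof -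
  let ?V = "vol d {z \<in> Rd d. affine_map d b k z \<in> A}"
  have "ennreal ((1 / \<bar>k\<bar>) ^ d) * vol d A = ?V * (ennreal (\<bar>k\<bar> ^ d) * ennreal ((1 / \<bar>k\<bar>) ^ d))"
    unfolding vol_homothety[OF k A, of b, symmetric] by (simp add: ac_simps)
  also have "ennreal (\<bar>k\<bar> ^ d) * ennreal ((1 / \<bar>k\<bar>) ^ d) = 1"
    using k by (simp add: ennreal_mult[symmetric] power_mult_distrib[symmetric])
  finally show ?thesis by simp
qed

section \<open>Convex bodies of finite volume\<close>

lemma convex_in_sum:
  assumes K: "convex_in d K"
  shows "finite J \<Longrightarrow> (\<And>j. j \<in> J \<Longrightarrow> p j \<in> K) \<Longrightarrow> (\<And>j. j \<in> J \<Longrightarrow> 0 \<le> \<beta> j) \<Longrightarrow> sum \<beta> J = 1 \<Longrightarrow>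
    (\<lambda>i\<in>{..<d}. \<Sum>j\<in>J. \<beta> j * p j i) \<in> K"
proof (induction J arbitrary: \<beta> rule: finite_induct)
  case empty
  then show ?case by simp
next
  case (insert k J)
  have KR: "K \<subseteq> Rd d" using K by (simp add: convex_in_def)
  have tot: "\<beta> k + sum \<beta> J = 1" using insert.hyps insert.prems(3) by simp
  have nn: "\<And>j. j \<in> J \<Longrightarrow> 0 \<le> \<beta> j" and nnk: "0 \<le> \<beta> k" and pk: "p k \<in> K"
    using insert.prems by auto
  show ?case
  proof (cases "sum \<beta> J = 0")
    case True
    then have z: "\<And>j. j \<in> J \<Longrightarrow> \<beta> j = 0" using sum_nonneg_eq_0_iff[OF insert.hyps(1), of \<beta>] nn by auto
    then have "(\<Sum>j\<in>J. \<beta> j * p j i) = 0" for i by (intro sum.neutral) simp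
    then have "(\<lambda>i\<in>{..<d}. \<Sum>j\<in>insert k J. \<beta> j * p j i) = restrict (p k) {..<d}"
      using insert.hyps tot True by auto
    also have "\<dots> = p k" using pk KR by (auto simp: Rd_def PiE_restrict)
    finally show ?thesis using pk by simp
  next
    case False
    define s where "s = sum \<beta> J"
    have s: "0 < s" using False sum_nonneg[of J \<beta>] nn by (simp add: s_def less_le)
    let ?q = "\<lambda>i\<in>{..<d}. \<Sum>j\<in>J. \<beta> j / s * p j i"
    have "?q \<in> K"
      using insert.prems(1) nn s
      by (intro insert.IH) (auto simp: s_def sum_divide_distrib[symmetric])
    then have "(\<lambda>i\<in>{..<d}. \<beta> k * p k i + s * ?q i) \<in> K"
      using K pk nnk s tot unfolding convex_in_def s_def[symmetric] by (meson less_imp_le)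
    moreover have "(\<lambda>i\<in>{..<d}. \<beta> k * p k i + s * ?q i) = (\<lambda>i\<in>{..<d}. \<Sum>j\<in>insert k J. \<beta> j * p j i)"
      using insert.hyps s by (intro restrict_ext) (simp add: sum_distrib_left)
    ultimately show ?thesis by (simp only:)
  qed
qed

text \<open>
  The embedding of the space as an affine hyperplane at height 1. It turns affine independence into linear
  independence: if the points \<open>lift d (p l)\<close> form a basis, then the coordinates of \<open>lift d x\<close> in it are the
  barycentric coordinates of \<open>x\<close> with respect to the simplex with vertices \<open>p l\<close>.
\<close>

definition lift :: "nat \<Rightarrow> (nat \<Rightarrow> real) \<Rightarrow> nat \<Rightarrow> real" where
  "lift d p i = (if i < d then p i else 1)"

lemma ip_lift: "ip (Suc d) (lift d p) v = ip d p v + v d"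
  by (simp add: ip_def lift_def)

lemma simplex_subset:
  assumes K: "convex_in d K" and p: "\<And>l. l < Suc d \<Longrightarrow> p l \<in> K"
    and bi: "biorthogonal (Suc d) (Suc d) (\<lambda>l. lift d (p l)) f"
    and x: "x \<in> Rd d" and nonneg: "\<And>l. l < Suc d \<Longrightarrow> 0 \<le> ip (Suc d) (lift d x) (f l)"
  shows "x \<in> K"
proof -
  let ?\<beta> = "\<lambda>l. ip (Suc d) (lift d x) (f l)"
  have e: "lift d x i = (\<Sum>l<Suc d. ?\<beta> l * lift d (p l) i)" if "i < Suc d" for i
    by (rule biorthogonal_expansion[OF bi that])
  have "sum ?\<beta> {..<Suc d} = 1" using e[of d] by (simp add: lift_def)
  then have "(\<lambda>i\<in>{..<d}. \<Sum>l<Suc d. ?\<beta> l * p l i) \<in> K"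
    using p nonneg by (intro convex_in_sum[OF K]) auto
  moreover have "(\<lambda>i\<in>{..<d}. \<Sum>l<Suc d. ?\<beta> l * p l i) = x"
  proof -
    have "(\<lambda>i\<in>{..<d}. \<Sum>l<Suc d. ?\<beta> l * p l i) = restrict x {..<d}"
    proof (rule restrict_ext)
      fix i assume "i \<in> {..<d}"
      then show "(\<Sum>l<Suc d. ?\<beta> l * p l i) = x i" using e[of i] by (simp add: lift_def)
    qed
    also have "\<dots> = x" using x by (auto simp: Rd_def PiE_restrict)
    finally show ?thesis .
  qed
  ultimately show ?thesis by simp
qed

text \<open>
  A linear relation satisfied by all lifted points would put \<open>K\<close> into a hyperplane, which is a null set.
\<close>

lemma lift_spanning:
  assumes K: "K \<subseteq> Rd d" and pos: "vol d K > 0" and v: "\<exists>i<Suc d. v i \<noteq> 0"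
  shows "\<exists>a\<in>lift d ` K. ip (Suc d) a v \<noteq> 0"
proof (rule ccontr)
  assume orth: "\<not> (\<exists>a\<in>lift d ` K. ip (Suc d) a v \<noteq> 0)"
  have h: "ip d v x = - v d" if "x \<in> K" for x
  proof -
    have "ip (Suc d) (lift d x) v = 0" using orth that by blast
    then show ?thesis by (simp add: ip_lift ip_commute[of d v])
  qed
  have "K \<noteq> {}" using pos by (auto simp: vol_def)
  show False
  proof (cases "\<exists>k<d. v k \<noteq> 0")
    case True
    then obtain k where k: "k < d" "v k \<noteq> 0" by blast
    let ?H = "{x \<in> Rd d. ip d v x = - v d}"
    have "?H \<in> sets (borel_Rd d)" unfolding space_borel_Rd[symmetric] by measurable
    then have "vol d K \<le> vol d ?H"
      unfolding vol_def using K h by (intro emeasure_mono) auto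
    then show False using vol_hyperplane[where a = v, OF k] pos by simp
  next
    case False
    then have "ip d v x = 0" for x by (simp add: ip_def)
    with h \<open>K \<noteq> {}\<close> have "v d = 0" by auto
    with False v show False by (auto simp: less_Suc_eq)
  qed
qed

text \<open>
  All barycentric coordinates of the centroid are equal and positive, so they stay nonnegative on a small
  cube around it.
\<close>

lemma simplex_centroid:
  assumes K: "convex_in d K" and p: "\<And>l. l < Suc d \<Longrightarrow> p l \<in> K"
    and bi: "biorthogonal (Suc d) (Suc d) (\<lambda>l. lift d (p l)) f"
  obtains c r where "c \<in> Rd d" "0 < r" "cube d c r \<subseteq> K"
    "\<And>l. l < Suc d \<Longrightarrow> ip (Suc d) (lift d c) (f l) = 1 / real (Suc d)"
proof -
  define c where "c = (\<lambda>i\<in>{..<d}. \<Sum>l<Suc d. 1 / real (Suc d) * p l i)"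
  have c: "c \<in> Rd d" by (simp add: c_def Rd_def)
  have lc: "lift d c i = (\<Sum>l<Suc d. 1 / real (Suc d) * lift d (p l) i)" for i
  proof -
    have "(\<Sum>l<Suc d. 1 / real (Suc d)) = 1" by (simp del: sum.lessThan_Suc)
    then show ?thesis by (simp add: lift_def c_def del: sum.lessThan_Suc)
  qed
  have bary: "ip (Suc d) (lift d c) (f l) = 1 / real (Suc d)" if "l < Suc d" for l
  proof -
    have "ip (Suc d) (lift d c) (f l) = (\<Sum>j<Suc d. 1 / real (Suc d) * ip (Suc d) (lift d (p j)) (f l))"
      unfolding lc by (rule ip_sum_left)
    also have "\<dots> = (\<Sum>j<Suc d. if j = l then 1 / real (Suc d) else 0)"
      using bi that by (intro sum.cong) (auto simp: biorthogonal_def)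
    finally show ?thesis using that by simp
  qed
  define S where "S = (\<Sum>l<Suc d. \<Sum>i<d. \<bar>f l i\<bar>)"
  have S: "0 \<le> S" by (simp add: S_def sum_nonneg)
  define r where "r = 1 / (real (Suc d) * (1 + S))"
  have r: "0 < r" using S by (simp add: r_def)
  have "cube d c r \<subseteq> K"
  proof
    fix x assume x: "x \<in> cube d c r"
    show "x \<in> K"
    proof (rule simplex_subset[OF K p bi])
      show "x \<in> Rd d" using x by (simp add: cube_def)
      fix l assume l: "l < Suc d"
      have "\<bar>ip d x (f l) - ip d c (f l)\<bar> = \<bar>\<Sum>i<d. (x i - c i) * f l i\<bar>"
        by (simp add: ip_def sum_subtractf algebra_simps)
      also have "\<dots> \<le> (\<Sum>i<d. r * \<bar>f l i\<bar>)"
        using x r by (intro order_trans[OF sum_abs] sum_mono) (auto simp: cube_def abs_mult intro: mult_right_mono)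
      also have "\<dots> = r * (\<Sum>i<d. \<bar>f l i\<bar>)" by (simp add: sum_distrib_left)
      also have "\<dots> \<le> r * S"
        unfolding S_def using l r by (intro mult_left_mono member_le_sum) (auto intro: sum_nonneg)
      also have "\<dots> = 1 / real (Suc d) * (S / (1 + S))" by (simp add: r_def)
      also have "\<dots> \<le> 1 / real (Suc d) * 1" using S by (intro mult_left_mono) auto
      finally have "\<bar>ip d x (f l) - ip d c (f l)\<bar> \<le> 1 / real (Suc d)" by simp
      then show "0 \<le> ip (Suc d) (lift d x) (f l)"
        using bary[OF l] by (simp add: ip_lift)
    qed
  qed
  with c r bary show thesis by (intro that[of c r]) auto
qed

text \<open>
  If \<open>K\<close> has a point \<open>x\<close> far away from the cube, then \<open>K\<close> contains many disjoint cubes of half the size, with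
  centers on the first half of the segment from \<open>c\<close> to \<open>x\<close>; their total volume would exceed the volume of \<open>K\<close>.
\<close>

lemma finite_volume_bounded:
  assumes K: "convex_in d K" and pos: "vol d K > 0" and fin: "vol d K < \<infinity>"
    and c: "c \<in> Rd d" and r: "0 < r" and cube: "cube d c r \<subseteq> K"
  obtains B where "\<And>x i. x \<in> K \<Longrightarrow> i < d \<Longrightarrow> \<bar>x i - c i\<bar> \<le> B"
proof -
  have KR: "K \<subseteq> Rd d" using K by (simp add: convex_in_def)
  \<comment> \<open>A set that is not measurable would have volume 0.\<close>
  have Kmeas: "K \<in> sets (completion (borel_Rd d))"
    using pos emeasure_notin_sets by (force simp: vol_def)
  obtain V where V: "0 \<le> V" "vol d K = ennreal V" using fin by (cases "vol d K") auto
  obtain N :: nat where "V < real N * r ^ d" using reals_Archimedean3[of "r ^ d"] r by auto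
  moreover from this V have N: "0 < N" by (cases N) auto
  ultimately have NV: "V < real N * r ^ d" "0 < N" by auto
  have "\<bar>x i - c i\<bar> \<le> 2 * real N * r" if x: "x \<in> K" and i: "i < d" for x i
  proof (rule ccontr)
    assume "\<not> ?thesis"
    then have far: "2 * real N * r < \<bar>x i - c i\<bar>" by simp
    define \<tau> where "\<tau> j = real j / (2 * real N)" for j :: nat
    define m where "m j k = c k + \<tau> j * (x k - c k)" for j k
    define Q where "Q j = cube d (m j) (r / 2)" for j
    have QK: "Q j \<subseteq> K" if "j < N" for j
    proof
      fix z assume z: "z \<in> Q j"
      have t: "0 \<le> \<tau> j" "\<tau> j \<le> 1 / 2" using \<open>j < N\<close> by (auto simp: \<tau>_def field_simps)
      \<comment> \<open>\<open>z\<close> lies between \<open>x\<close> and the point \<open>w\<close> of the cube around \<open>c\<close>.\<close>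
      define w where "w = (\<lambda>k\<in>{..<d}. c k + (z k - m j k) / (1 - \<tau> j))"
      have "\<bar>(z k - m j k) / (1 - \<tau> j)\<bar> \<le> r" if "k < d" for k
      proof -
        have "\<bar>z k - m j k\<bar> \<le> r / 2" using z that by (simp add: Q_def cube_def)
        also have "\<dots> \<le> r * (1 - \<tau> j)" using t r by (simp add: field_simps)
        finally show ?thesis using t by (simp add: pos_divide_le_eq)
      qed
      then have "w \<in> cube d c r" by (auto simp: cube_def w_def Rd_def)
      with cube have "w \<in> K" by blast
      then have "(\<lambda>k\<in>{..<d}. (1 - \<tau> j) * w k + \<tau> j * x k) \<in> K"
        using K x t by (simp add: convex_in_def)
      also have "(\<lambda>k\<in>{..<d}. (1 - \<tau> j) * w k + \<tau> j * x k) = restrict z {..<d}"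
        using t by (intro restrict_ext) (simp add: w_def m_def distrib_left, simp add: algebra_simps)
      also have "\<dots> = z" using z by (auto simp: Q_def cube_def Rd_def PiE_restrict)
      finally show "z \<in> K" .
    qed
    have Qmeas: "Q j \<in> sets (completion (borel_Rd d))" for j
      unfolding Q_def by (intro sets_vol cube_sets)
    have disj: "disjoint_family_on Q {..<N}"
      unfolding disjoint_family_on_def
    proof (intro ballI impI)
      fix j j' :: nat assume jj: "j \<noteq> j'"
      show "Q j \<inter> Q j' = {}"
      proof (rule ccontr)
        assume "Q j \<inter> Q j' \<noteq> {}"
        then obtain z where "z \<in> Q j" "z \<in> Q j'" by blast
        then have "\<bar>z i - m j i\<bar> \<le> r / 2" "\<bar>z i - m j' i\<bar> \<le> r / 2"
          using i by (auto simp: Q_def cube_def)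
        then have "\<bar>m j i - m j' i\<bar> \<le> r" by linarith
        moreover have "m j i - m j' i = (real j - real j') / (2 * real N) * (x i - c i)"
          by (simp add: m_def \<tau>_def add_divide_distrib diff_divide_distrib algebra_simps)
        moreover have "1 \<le> \<bar>real j - real j'\<bar>" using jj by linarith
        ultimately have le: "\<bar>real j - real j'\<bar> / (2 * real N) * \<bar>x i - c i\<bar> \<le> r"
          and ge: "1 \<le> \<bar>real j - real j'\<bar>" using N by (simp_all add: abs_mult)
        have "r < 1 / (2 * real N) * \<bar>x i - c i\<bar>" using far N by (simp add: field_simps)
        also have "\<dots> \<le> \<bar>real j - real j'\<bar> / (2 * real N) * \<bar>x i - c i\<bar>"
          using ge N by (intro mult_right_mono divide_right_mono) auto
        finally show False using le by simp
      qed
    qed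
    have "ennreal (real N * r ^ d) = (\<Sum>j<N. vol d (Q j))"
      using r by (simp add: Q_def vol_cube ennreal_mult ennreal_of_nat_eq_real_of_nat)
    also have "\<dots> = vol d (\<Union>j<N. Q j)"
      unfolding vol_def using disj Qmeas by (intro sum_emeasure) auto
    also have "\<dots> \<le> vol d K"
      unfolding vol_def using QK Kmeas by (intro emeasure_mono) auto
    finally show False using V NV r by (simp add: ennreal_le_iff)
  qed
  then show thesis by (rule that)
qed

text \<open>
  The point \<open>c\<close> is the centroid of an inscribed simplex of almost maximal volume, obtained by applying the
  Auerbach lemma to the lifted points of \<open>K\<close>. Every point of \<open>K\<close> has barycentric coordinates of at most
  \<open>\<rho> = 1 + 1 / (d + 1)\<close> with respect to this simplex. Reflection in \<open>c\<close> with ratio \<open>q = 1 / (d + 1)\<close> takes a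
  coordinate \<open>b\<close> to \<open>q (1 + q - b)\<close>, which is nonnegative exactly for \<open>b \<le> \<rho>\<close>; so the image lies in the simplex.
\<close>

lemma reflection_center:
  assumes K: "convex_in d K" and pos: "vol d K > 0" and fin: "vol d K < \<infinity>"
  obtains c r B where "c \<in> Rd d" "0 < r" "cube d c r \<subseteq> K"
    "\<And>x i. x \<in> K \<Longrightarrow> i < d \<Longrightarrow> \<bar>x i - c i\<bar> \<le> B"
    "\<And>x. x \<in> K \<Longrightarrow> (\<lambda>i\<in>{..<d}. c i - (x i - c i) / real (Suc d)) \<in> K"
proof -
  have KR: "K \<subseteq> Rd d" using K by (simp add: convex_in_def)
  note span = lift_spanning[OF KR pos]
  have simplex: "\<exists>p. (\<forall>l<Suc d. p l \<in> K) \<and> (\<forall>l<Suc d. u l = lift d (p l))"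
    if "\<forall>l<Suc d. u l \<in> lift d ` K" for u :: "nat \<Rightarrow> nat \<Rightarrow> real"
  proof -
    have "\<forall>l\<in>{..<Suc d}. \<exists>p. p \<in> K \<and> u l = lift d p" using that by blast
    then obtain p where "\<forall>l\<in>{..<Suc d}. p l \<in> K \<and> u l = lift d (p l)" using bchoice by metis
    then show ?thesis by (intro exI[of _ p]) auto
  qed
  \<comment> \<open>The Auerbach lemma requires \<open>K\<close> to be bounded; for this, any nondegenerate inscribed simplex is good enough.\<close>
  obtain u0 f0 where u0: "\<forall>l<Suc d. u0 l \<in> lift d ` K" "biorthogonal (Suc d) (Suc d) u0 f0"
    using biorthogonal_exists[OF span order.refl] by blast
  obtain p0 where p0: "\<forall>l<Suc d. p0 l \<in> K" "\<forall>l<Suc d. u0 l = lift d (p0 l)"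
    using simplex[OF u0(1)] by blast
  have bi0: "biorthogonal (Suc d) (Suc d) (\<lambda>l. lift d (p0 l)) f0"
    using u0(2) p0(2) by (simp add: biorthogonal_def)
  obtain c0 r0 where c0: "c0 \<in> Rd d" "0 < r0" "cube d c0 r0 \<subseteq> K"
    by (rule simplex_centroid[OF K p0(1)[rule_format] bi0]) (assumption, rule that)
  obtain B0 where B0: "\<And>x i. x \<in> K \<Longrightarrow> i < d \<Longrightarrow> \<bar>x i - c0 i\<bar> \<le> B0"
    using finite_volume_bounded[OF K pos fin c0] by blast
  have bound: "\<bar>a i\<bar> \<le> 1 + (\<Sum>i<d. \<bar>c0 i\<bar>) + \<bar>B0\<bar>" if a: "a \<in> lift d ` K" and i: "i < Suc d" for a i
  proof -
    obtain x where x: "x \<in> K" "a = lift d x" using a by blast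
    have nn: "0 \<le> (\<Sum>i<d. \<bar>c0 i\<bar>)" by (simp add: sum_nonneg)
    show ?thesis
    proof (cases "i < d")
      case True
      have "\<bar>c0 i\<bar> \<le> (\<Sum>i<d. \<bar>c0 i\<bar>)" using True by (intro member_le_sum) auto
      with B0[OF x(1) True] show ?thesis using x(2) True by (simp add: lift_def)
    qed (use x(2) nn in \<open>simp add: lift_def\<close>)
  qed
  define \<rho> where "\<rho> = real (d + 2) / real (d + 1)"
  have "1 < \<rho>" by (simp add: \<rho>_def)
  obtain u f where u: "\<And>l. l < Suc d \<Longrightarrow> u l \<in> lift d ` K" and bi: "biorthogonal (Suc d) (Suc d) u f"
    and near: "\<And>a l. a \<in> lift d ` K \<Longrightarrow> l < Suc d \<Longrightarrow> \<bar>ip (Suc d) a (f l)\<bar> \<le> \<rho>"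
    by (rule auerbach_system[of "Suc d" "lift d ` K" "1 + (\<Sum>i<d. \<bar>c0 i\<bar>) + \<bar>B0\<bar>" \<rho>])
      (erule span, erule (1) bound, rule \<open>1 < \<rho>\<close>, rule that)
  obtain p where p: "\<forall>l<Suc d. p l \<in> K" "\<forall>l<Suc d. u l = lift d (p l)"
    using simplex[of u] u by blast
  have bi: "biorthogonal (Suc d) (Suc d) (\<lambda>l. lift d (p l)) f"
    using bi p(2) by (simp add: biorthogonal_def)
  obtain c r where c: "c \<in> Rd d" "0 < r" "cube d c r \<subseteq> K"
    and bary: "\<And>l. l < Suc d \<Longrightarrow> ip (Suc d) (lift d c) (f l) = 1 / real (Suc d)"
    by (rule simplex_centroid[OF K p(1)[rule_format] bi]) (assumption, rule that)
  obtain B where B: "\<And>x i. x \<in> K \<Longrightarrow> i < d \<Longrightarrow> \<bar>x i - c i\<bar> \<le> B"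
    using finite_volume_bounded[OF K pos fin c] by blast
  have "(\<lambda>i\<in>{..<d}. c i - (x i - c i) / real (Suc d)) \<in> K" if x: "x \<in> K" for x
  proof (rule simplex_subset[OF K _ bi])
    let ?y = "\<lambda>i\<in>{..<d}. c i - (x i - c i) / real (Suc d)"
    show "?y \<in> Rd d" by (simp add: Rd_def)
    fix l assume l: "l < Suc d"
    show "p l \<in> K" using p(1) l by blast
    define q where "q = 1 / real (Suc d)"
    have q: "0 < q" "real (Suc d) * q = 1" by (auto simp: q_def)
    have "ip (Suc d) (lift d ?y) (f l) = ip (Suc d) (\<lambda>i. (1 + q) * lift d c i - q * lift d x i) (f l)"
      by (rule ip_cong_left) (auto simp: lift_def q_def diff_divide_distrib algebra_simps)
    also have "\<dots> = (1 + q) * ip (Suc d) (lift d c) (f l) - q * ip (Suc d) (lift d x) (f l)"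
      by (simp only: ip_commute[of _ _ "f l"] ip_diff ip_scale)
    also have "\<dots> = q * ((1 + q) - ip (Suc d) (lift d x) (f l))"
      using bary[OF l] by (simp add: q_def algebra_simps)
    also have "\<dots> \<ge> 0"
    proof -
      have "ip (Suc d) (lift d x) (f l) \<le> \<rho>" using near[of "lift d x" l] x l by force
      also have "\<rho> = 1 + q" by (simp add: \<rho>_def q_def field_simps)
      finally show ?thesis using q(1) by simp
    qed
    finally show "0 \<le> ip (Suc d) (lift d ?y) (f l)" .
  qed
  with c B show thesis by (intro that[of c r B]) auto
qed


section \<open>Selection of the subfamily\<close>

lemma family_Inter_convex:
  assumes "\<forall>K\<in>\<F>. convex_in d K"
  shows "convex_in d (family_Inter d \<F>)"
  using assms unfolding convex_in_def family_Inter_def by (auto simp: Rd_def)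

text \<open>
  The argument sketched at the beginning. The choices \<open>\<rho> = 1 + 1 / (2 d)\<close> and \<open>\<sigma> = d / (d + 1)\<close> satisfy
  \<open>\<rho> \<sigma> < 1\<close>, as needed for the inner simplex \<open>A\<close> to lie in \<open>K\<close>; the choice \<open>s = 1 / (d (d + 2))\<close> satisfies
  \<open>s d (d + 1) < 1\<close>, as needed for \<open>w\<close> to lie in the hull of \<open>X\<close>. The ratio of the outer simplex to \<open>A\<close> is
  \<open>(d + 1 / s) / \<sigma> = (d + 1) (d + 3)\<close>.
\<close>

lemma volume_helly_bound:
  assumes d: "1 \<le> d" and conv: "\<forall>K\<in>\<F>. convex_in d K"
    and pos: "vol d (family_Inter d \<F>) > 0" and fin: "vol d (family_Inter d \<F>) < \<infinity>"
  obtains \<G> where "\<G> \<subseteq> \<F>" "finite \<G>" "card \<G> \<le> 2 * d"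
    "vol d (family_Inter d \<G>) \<le> ennreal (((real d + 1) * (real d + 3)) ^ d) * vol d (family_Inter d \<F>)"
proof -
  define K where "K = family_Inter d \<F>"
  have Kconv: "convex_in d K" unfolding K_def by (rule family_Inter_convex[OF conv])
  have KF: "K \<subseteq> L" if "L \<in> \<F>" for L using that by (auto simp: K_def family_Inter_def)
  obtain c r B where c: "c \<in> Rd d" and r: "0 < r" and cube: "cube d c r \<subseteq> K"
    and B: "\<And>x i. x \<in> K \<Longrightarrow> i < d \<Longrightarrow> \<bar>x i - c i\<bar> \<le> B"
    and reflect: "\<And>x. x \<in> K \<Longrightarrow> (\<lambda>i\<in>{..<d}. c i - (x i - c i) / real (Suc d)) \<in> K"
    using reflection_center[OF Kconv, folded K_def] pos fin unfolding K_def by blast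
  define X where "X = {a. \<exists>L\<in>\<F>. \<forall>x\<in>L. ip d a (\<lambda>i. x i - c i) \<le> 1}"
  have XK: "ip d a (\<lambda>i. x i - c i) \<le> 1" if "a \<in> X" "x \<in> K" for a x
    using that KF by (auto simp: X_def)
  define pt where "pt y = (\<lambda>i\<in>{..<d}. c i + y i)" for y :: "nat \<Rightarrow> real"
  have pt_Rd: "pt y \<in> Rd d" for y by (simp add: pt_def Rd_def)
  have pt_minus: "ip d a (\<lambda>i. pt y i - c i) = ip d a y" for a y
    by (rule ip_cong) (simp add: pt_def)
  have cut: "\<exists>a\<in>X. 1 \<le> ip d a y" if out: "pt y \<notin> K" for y
  proof -
    obtain L where L: "L \<in> \<F>" "pt y \<notin> L"
      using out pt_Rd by (auto simp: K_def family_Inter_def)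
    have "x \<in> L" if "x \<in> Rd d" "\<And>i. i < d \<Longrightarrow> \<bar>x i - c i\<bar> \<le> r" for x
      using that cube KF[OF L(1)] by (auto simp: cube_def)
    then obtain a where a: "\<And>x. x \<in> L \<Longrightarrow> ip d a (\<lambda>i. x i - c i) \<le> 1"
      "1 \<le> ip d a (\<lambda>i. pt y i - c i)"
      using convex_in_separation[OF _ _ c r pt_Rd L(2)] conv L(1) by blast
    then show ?thesis using L(1) by (auto simp: X_def pt_minus)
  qed
  \<comment> \<open>Since \<open>K\<close> is bounded, every ray from \<open>c\<close> leaves it.\<close>
  have escape: "\<exists>t\<ge>0. pt (\<lambda>i. t * y i) \<notin> K" if y: "\<exists>i<d. y i \<noteq> 0" for y
  proof (rule ccontr)
    assume *: "\<not> ?thesis"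
    obtain i where i: "i < d" "y i \<noteq> 0" using y by blast
    define t where "t = (\<bar>B\<bar> + 1) / \<bar>y i\<bar>"
    have "0 \<le> t" by (simp add: t_def)
    then have "\<bar>pt (\<lambda>i. t * y i) i - c i\<bar> \<le> B" using * B[OF _ i(1)] by blast
    then have "\<bar>t * y i\<bar> \<le> B" using i by (simp add: pt_def)
    moreover have "\<bar>t * y i\<bar> = \<bar>B\<bar> + 1" using i by (simp add: t_def abs_mult)
    ultimately show False by linarith
  qed
  have span: "\<exists>a\<in>X. ip d a v \<noteq> 0" if v: "\<exists>i<d. v i \<noteq> 0" for v
  proof -
    obtain t where "pt (\<lambda>i. t * v i) \<notin> K" using escape[OF v] by blast
    then obtain a where "a \<in> X" "1 \<le> t * ip d a v" using cut[of "\<lambda>i. t * v i"] by (auto simp: ip_scale)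
    then show ?thesis by (intro bexI[of _ a]) auto
  qed
  have bound: "\<bar>a i\<bar> \<le> 1 / r" if a: "a \<in> X" and i: "i < d" for a i
  proof -
    define x where "x = pt (\<lambda>j. if j = i then r * sgn (a i) else 0)"
    have "x \<in> cube d c r"
      using pt_Rd r by (auto simp: cube_def x_def pt_def sgn_real_def Rd_def)
    then have "ip d a (\<lambda>j. x j - c j) \<le> 1" using XK[OF a] cube by blast
    moreover have "ip d a (\<lambda>j. x j - c j) = (\<Sum>j<d. if j = i then r * \<bar>a i\<bar> else 0)"
      unfolding x_def pt_minus unfolding ip_def by (intro sum.cong) (auto simp: abs_sgn)
    ultimately show ?thesis using i r by (simp add: field_simps)
  qed
  define \<rho> where "\<rho> = 1 + 1 / (2 * real d)"
  have \<rho>: "1 < \<rho>" using d by (simp add: \<rho>_def)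
  obtain u f where u: "\<And>l. l < d \<Longrightarrow> u l \<in> X" and bi: "biorthogonal d d u f"
    and near: "\<And>a l. a \<in> X \<Longrightarrow> l < d \<Longrightarrow> \<bar>ip d a (f l)\<bar> \<le> \<rho>"
    by (rule auerbach_system[of d X "1 / r" \<rho>])
      (erule span, erule (1) bound, rule \<rho>, rule that)
  define \<sigma> where "\<sigma> = real d / (real d + 1)"
  have "\<rho> * real d = real d + 1 / 2" using d by (simp add: \<rho>_def field_simps)
  then have \<rho>\<sigma>: "\<rho> * \<sigma> < 1" by (simp add: \<sigma>_def)
  \<comment> \<open>The inner simplex.\<close>
  define A where "A = {x \<in> Rd d. (\<forall>l<d. 0 \<le> ip d (u l) x - ip d (u l) c) \<and>
    (\<Sum>l<d. ip d (u l) x - ip d (u l) c) \<le> \<sigma>}"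
  have A_sets: "A \<in> sets (borel_Rd d)"
    unfolding A_def space_borel_Rd[symmetric] by measurable
  have AK: "A \<subseteq> K"
  proof
    fix x assume x: "x \<in> A"
    define y where "y i = x i - c i" for i
    have y: "ip d b y = ip d b x - ip d b c" for b
      unfolding y_def by (rule ip_diff)
    have "pt y = restrict x {..<d}" by (simp add: pt_def y_def)
    then have "pt y = x" using x by (auto simp: A_def Rd_def PiE_restrict)
    moreover have "pt y \<in> K"
    proof (rule ccontr)
      assume "pt y \<notin> K"
      then obtain a where a: "a \<in> X" "1 \<le> ip d a y" using cut by blast
      have "ip d a y = (\<Sum>l<d. ip d a (f l) * ip d (u l) y)"
        by (rule biorthogonal_ip_expansion[OF bi])
      also have "\<dots> \<le> (\<Sum>l<d. \<rho> * ip d (u l) y)"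
        using near[OF a(1)] x by (intro sum_mono mult_right_mono) (auto simp: A_def y abs_le_iff)
      also have "\<dots> = \<rho> * (\<Sum>l<d. ip d (u l) y)" by (simp add: sum_distrib_left)
      also have "\<dots> \<le> \<rho> * \<sigma>" using x \<rho> by (intro mult_left_mono) (auto simp: A_def y)
      finally show False using a(2) \<rho>\<sigma> by simp
    qed
    ultimately show "x \<in> K" by simp
  qed
  define s where "s = 1 / (real d * (real d + 2))"
  have s: "0 < s" using d by (simp add: s_def)
  define w where "w i = (\<Sum>l<d. - s * u l i)" for i
  have w: "ip d w y = - s * (\<Sum>l<d. ip d (u l) y)" for y
    unfolding w_def by (simp only: ip_sum_left sum_distrib_left)
  \<comment> \<open>If \<open>w\<close> were separated by \<open>y\<close>, then \<open>K\<close> would extend from \<open>c\<close> in direction \<open>y\<close> almost up to where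
    \<open>\<langle>w, \<cdot>\<rangle>\<close> is 1, and without end if \<open>\<langle>w, y\<rangle> = 0\<close>. The reflection of such a point of \<open>K\<close> is also in \<open>K\<close>
    and satisfies the inequalities given by the \<open>u l\<close>; added up, they bound \<open>\<langle>w, \<cdot>\<rangle>\<close> at the original point
    by \<open>s d (d + 1) < 1\<close>, a contradiction.\<close>
  have "w \<in> subconvex_hull d X"
  proof (rule ccontr)
    assume "w \<notin> subconvex_hull d X"
    then obtain y where y: "\<exists>i<d. y i \<noteq> 0" and h: "0 \<le> ip d w y"
      and le: "\<And>a. a \<in> X \<Longrightarrow> ip d a y \<le> ip d w y"
      by (rule subconvex_hull_separation) (rule that)
    define h where "h = ip d w y"
    have h: "0 \<le> h" and le: "\<And>a. a \<in> X \<Longrightarrow> ip d a y \<le> h" using h le by (auto simp: h_def)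
    have inK: "pt (\<lambda>i. t * y i) \<in> K" if "0 \<le> t" "t * h < 1" for t
    proof (rule ccontr)
      assume "pt (\<lambda>i. t * y i) \<notin> K"
      then obtain a where a: "a \<in> X" "1 \<le> t * ip d a y" using cut[of "\<lambda>i. t * y i"] by (auto simp: ip_scale)
      have "t * ip d a y \<le> t * h" using le[OF a(1)] that(1) by (rule mult_left_mono)
      with a(2) that(2) show False by simp
    qed
    have small: "t * h \<le> (real d + 1) / (real d + 2)" if t: "0 \<le> t" "t * h < 1" for t
    proof -
      define x' where "x' = (\<lambda>i\<in>{..<d}. c i - (pt (\<lambda>i. t * y i) i - c i) / real (Suc d))"
      have x': "x' \<in> K" unfolding x'_def by (rule reflect[OF inK[OF t]])
      have "- (t * ip d (u l) y) \<le> real d + 1" if l: "l < d" for l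
      proof -
        have "ip d (u l) (\<lambda>i. x' i - c i) = ip d (u l) (\<lambda>i. - (t / real (Suc d)) * y i)"
          by (rule ip_cong) (simp add: x'_def pt_def)
        then have "- (t / real (Suc d)) * ip d (u l) y \<le> 1"
          using XK[OF u[OF l] x'] by (simp only: ip_scale)
        then show ?thesis by (simp add: field_simps)
      qed
      then have "(\<Sum>l<d. - (t * ip d (u l) y)) \<le> (\<Sum>l<d. real d + 1)" by (intro sum_mono) auto
      then have "s * (\<Sum>l<d. - (t * ip d (u l) y)) \<le> s * (real d * (real d + 1))"
        using s by (intro mult_left_mono) auto
      also have "s * (real d * (real d + 1)) = (real d + 1) / (real d + 2)"
        using d by (simp add: s_def)
      also have "s * (\<Sum>l<d. - (t * ip d (u l) y)) = t * h"
        by (simp add: h_def w sum_negf sum_distrib_left[symmetric])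
      finally show ?thesis .
    qed
    show False
    proof (cases "h = 0")
      case True
      then show False using escape[OF y] inK by auto
    next
      case False
      \<comment> \<open>A number strictly between \<open>(d + 1) / (d + 2)\<close> and 1.\<close>
      define \<theta> where "\<theta> = (2 * real d + 3) / (2 * real d + 4)"
      have \<theta>: "0 \<le> \<theta>" "\<theta> < 1" "(real d + 1) / (real d + 2) < \<theta>"
        by (auto simp: \<theta>_def field_simps)
      show False using small[of "\<theta> / h"] \<theta> h False by simp
    qed
  qed
  then obtain W \<mu> where W: "finite W" "W \<subseteq> X" "card W \<le> d"
    and \<mu>: "\<And>a. a \<in> W \<Longrightarrow> 0 \<le> \<mu> a" "sum \<mu> W \<le> 1" "\<And>i. i < d \<Longrightarrow> w i = (\<Sum>a\<in>W. \<mu> a * a i)"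
    by (rule subconvex_hull_caratheodory) (rule that)
  define \<kappa> where "\<kappa> a = (SOME L. L \<in> \<F> \<and> (\<forall>x\<in>L. ip d a (\<lambda>i. x i - c i) \<le> 1))" for a
  have \<kappa>: "\<kappa> a \<in> \<F> \<and> (\<forall>x\<in>\<kappa> a. ip d a (\<lambda>i. x i - c i) \<le> 1)" if "a \<in> X" for a
    unfolding \<kappa>_def by (rule someI_ex) (use that in \<open>simp add: X_def Bex_def\<close>)
  define \<G> where "\<G> = \<kappa> ` (u ` {..<d} \<union> W)"
  have "\<G> \<subseteq> \<F>" using \<kappa> u W(2) by (auto simp: \<G>_def)
  moreover have "finite \<G>" using W(1) by (simp add: \<G>_def)
  moreover have "card \<G> \<le> 2 * d"
  proof -
    have "card \<G> \<le> card (u ` {..<d} \<union> W)" unfolding \<G>_def using W(1) by (intro card_image_le) auto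
    also have "\<dots> \<le> card (u ` {..<d}) + card W" by (rule card_Un_le)
    also have "card (u ` {..<d}) \<le> d" using card_image_le[of "{..<d}" u] by simp
    finally show ?thesis using W(3) by simp
  qed
  moreover have "vol d (family_Inter d \<G>) \<le> ennreal (((real d + 1) * (real d + 3)) ^ d) * vol d K"
  proof -
    define R where "R = (real d + 1) * (real d + 3)"
    have R: "0 < R" by (simp add: R_def add_pos_pos)
    \<comment> \<open>\<open>g\<close> is the vertex of the outer simplex where all the inequalities \<open>\<langle>u l, y\<rangle> \<le> 1\<close> are equalities. It corresponds
      to the vertex \<open>c\<close> of \<open>A\<close>, and \<open>c + y\<close> is mapped to \<open>c + (g - y) / R\<close>.\<close>
    define g where "g i = (\<Sum>l<d. 1 * f l i)" for i
    have g: "ip d (u l) g = 1" if "l < d" for l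
    proof -
      have "ip d (u l) g = (\<Sum>m<d. 1 * ip d (u l) (f m))" unfolding g_def by (rule ip_sum)
      also have "\<dots> = (\<Sum>m<d. if m = l then 1 else 0)"
        using bi that by (intro sum.cong) (auto simp: biorthogonal_def)
      finally show ?thesis using that by simp
    qed
    define b where "b i = c i + (1 / R) * (c i + g i)" for i
    let ?T = "affine_map d b (- (1 / R))"
    have "family_Inter d \<G> \<subseteq> {z \<in> Rd d. ?T z \<in> A}"
    proof
      fix z assume z: "z \<in> family_Inter d \<G>"
      have zR: "z \<in> Rd d" using z by (simp add: family_Inter_def)
      define y where "y i = z i - c i" for i
      have cut_z: "ip d a y \<le> 1" if "a \<in> u ` {..<d} \<union> W" for a
      proof -
        have "a \<in> X" using that u W(2) by auto
        moreover have "z \<in> \<kappa> a" using z that by (auto simp: family_Inter_def \<G>_def)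
        ultimately show ?thesis using \<kappa> by (auto simp: y_def[abs_def])
      qed
      have uy: "ip d (u l) y \<le> 1" if "l < d" for l using cut_z that by simp
      have "ip d w y = (\<Sum>a\<in>W. \<mu> a * ip d a y)"
      proof -
        have "ip d w y = ip d (\<lambda>i. \<Sum>a\<in>W. \<mu> a * a i) y" by (rule ip_cong_left) (rule \<mu>(3))
        then show ?thesis by (simp add: ip_sum_left)
      qed
      also have "\<dots> \<le> (\<Sum>a\<in>W. \<mu> a * 1)" using cut_z \<mu>(1) by (intro sum_mono mult_left_mono) auto
      also have "\<dots> \<le> 1" using \<mu>(2) by simp
      finally have "- (\<Sum>l<d. ip d (u l) y) \<le> 1 / s" using s by (simp add: w field_simps)
      then have sum_y: "- (\<Sum>l<d. ip d (u l) y) \<le> real d * (real d + 2)" by (simp add: s_def)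
      have T: "ip d (u l) (?T z) - ip d (u l) c = (1 - ip d (u l) y) / R" if "l < d" for l
      proof -
        have "ip d (u l) (?T z) = ip d (u l) (\<lambda>i. c i + (1 / R) * (g i - y i))"
          by (rule ip_cong) (simp add: affine_map_def b_def y_def algebra_simps)
        also have "\<dots> = ip d (u l) c + (1 / R) * (ip d (u l) g - ip d (u l) y)"
          by (simp only: ip_add ip_scale ip_diff)
        finally show ?thesis using g[OF that] by simp
      qed
      have "(\<Sum>l<d. ip d (u l) (?T z) - ip d (u l) c) = (\<Sum>l<d. (1 - ip d (u l) y) / R)"
        using T by (intro sum.cong) auto
      also have "\<dots> = (real d - (\<Sum>l<d. ip d (u l) y)) / R"
        by (simp add: sum_divide_distrib[symmetric] sum_subtractf)
      also have "\<dots> \<le> (real d * (real d + 3)) / R"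
        using sum_y R by (intro divide_right_mono) (auto simp: algebra_simps)
      also have "\<dots> = \<sigma>" by (simp add: R_def \<sigma>_def)
      finally have sum_T: "(\<Sum>l<d. ip d (u l) (?T z) - ip d (u l) c) \<le> \<sigma>" .
      have nonneg_T: "0 \<le> ip d (u l) (?T z) - ip d (u l) c" if "l < d" for l
        unfolding T[OF that] using uy[OF that] R by simp
      have "?T z \<in> Rd d" by (simp add: affine_map_def Rd_def)
      with sum_T nonneg_T have "?T z \<in> A" unfolding A_def by blast
      with zR show "z \<in> {z \<in> Rd d. ?T z \<in> A}" by simp
    qed
    moreover have "{z \<in> Rd d. ?T z \<in> A} \<in> sets (borel_Rd d)"
    proof -
      have "{z \<in> Rd d. ?T z \<in> A} = ?T -` A \<inter> space (borel_Rd d)"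
        by (auto simp: space_borel_Rd)
      then show ?thesis using measurable_sets[OF affine_map_measurable A_sets] by simp
    qed
    ultimately have "vol d (family_Inter d \<G>) \<le> vol d {z \<in> Rd d. ?T z \<in> A}"
      unfolding vol_def by (intro emeasure_mono) auto
    also have "\<dots> = ennreal (R ^ d) * vol d A"
      using R by (subst vol_homothety_preimage[OF _ A_sets]) auto
    also have "vol d A \<le> vol d K"
    proof -
      have "K \<in> sets (completion (borel_Rd d))"
        using pos emeasure_notin_sets by (force simp: vol_def K_def)
      then show ?thesis unfolding vol_def using AK by (rule emeasure_mono[rotated])
    qed
    finally show ?thesis by (simp add: R_def mult_left_mono)
  qed
  ultimately show thesis by (intro that[of \<G>]) (auto simp: K_def)
qed

lemma ratio_power_bound:
  assumes d: "1 \<le> d"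
  shows "((real d + 1) * (real d + 3)) ^ d \<le> exp 4 * real d ^ (2 * d)"
proof -
  have factor: "(real d + a) ^ d \<le> exp a * real d ^ d" if "0 \<le> a" for a
  proof -
    have "real d + a = real d * (1 + a / real d)" using d by (simp add: field_simps)
    also have "\<dots> \<le> real d * exp (a / real d)"
      using exp_ge_add_one_self[of "a / real d"] by (intro mult_left_mono) auto
    finally have "(real d + a) ^ d \<le> (real d * exp (a / real d)) ^ d"
      using that by (intro power_mono) auto
    also have "\<dots> = real d ^ d * exp (real d * (a / real d))"
      by (simp only: power_mult_distrib exp_of_nat_mult)
    finally show ?thesis using d by (simp add: mult.commute)
  qed
  have "((real d + 1) * (real d + 3)) ^ d \<le> (exp 1 * real d ^ d) * (exp 3 * real d ^ d)"
    unfolding power_mult_distrib using factor[of 1] factor[of 3] by (intro mult_mono) auto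
  also have "\<dots> = exp (1 + 3) * real d ^ (2 * d)"
    by (simp only: exp_add mult_2 mult_2_right power_add ac_simps)
  finally show ?thesis by simp
qed

text \<open>
  An intersection of infinite volume is handled by the empty subfamily, since \<open>C * exp d * d ^ (2 * d)\<close> is positive.
\<close>

theorem theorem1p1:
  shows "\<exists>C::real. C > 0 \<and>
    (\<forall>d::nat. d \<ge> 1 \<longrightarrow>
      (\<forall>\<F> :: (nat \<Rightarrow> real) set set.
        (\<forall>K\<in>\<F>. convex_in d K) \<and> vol d (family_Inter d \<F>) > 0 \<longrightarrow>
        (\<exists>\<G>. \<G> \<subseteq> \<F> \<and> finite \<G> \<and> card \<G> \<le> 2 * d \<and>
          vol d (family_Inter d \<G>)
            \<le> ennreal (C * exp (real d) * real d ^ (2 * d)) * vol d (family_Inter d \<F>))))"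
proof (intro exI[of _ "exp 4"] conjI allI impI)
  show "(0::real) < exp 4" by simp
  fix d :: nat and \<F> :: "(nat \<Rightarrow> real) set set"
  assume d: "1 \<le> d" and F: "(\<forall>K\<in>\<F>. convex_in d K) \<and> vol d (family_Inter d \<F>) > 0"
  let ?C = "exp 4 * exp (real d) * real d ^ (2 * d)"
  show "\<exists>\<G>. \<G> \<subseteq> \<F> \<and> finite \<G> \<and> card \<G> \<le> 2 * d \<and>
    vol d (family_Inter d \<G>) \<le> ennreal ?C * vol d (family_Inter d \<F>)"
  proof (cases "vol d (family_Inter d \<F>) = \<infinity>")
    case True
    have "0 < ?C" using d by simp
    then have "ennreal ?C * vol d (family_Inter d \<F>) = \<infinity>"
      using True d by (auto simp: ennreal_mult_top)
    then show ?thesis by (intro exI[of _ "{}"]) simp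
  next
    case False
    then have "vol d (family_Inter d \<F>) < \<infinity>" by (simp add: less_top)
    then obtain \<G> where G: "\<G> \<subseteq> \<F>" "finite \<G>" "card \<G> \<le> 2 * d"
      and le: "vol d (family_Inter d \<G>)
        \<le> ennreal (((real d + 1) * (real d + 3)) ^ d) * vol d (family_Inter d \<F>)"
      using volume_helly_bound[OF d] F by blast
    have "((real d + 1) * (real d + 3)) ^ d \<le> exp 4 * real d ^ (2 * d) * 1"
      using ratio_power_bound[OF d] by simp
    also have "\<dots> \<le> exp 4 * real d ^ (2 * d) * exp (real d)" by (intro mult_left_mono) auto
    finally have "((real d + 1) * (real d + 3)) ^ d \<le> ?C" by (simp add: ac_simps)
    then have "ennreal (((real d + 1) * (real d + 3)) ^ d) * vol d (family_Inter d \<F>)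
        \<le> ennreal ?C * vol d (family_Inter d \<F>)"
      by (intro mult_right_mono ennreal_leI) auto
    with le G show ?thesis by (meson order_trans)
  qed
qed

end
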